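(* For an artin algebra $A$ and a finitely generated left $A$-module $M$ consider the conditions: (G1) $M$ is semi-Gorenstein-projective; (G2) the $A$-dual $M^*=\operatorname{Hom}(M,{}_AA)$ of $M$ is semi-Gorenstein-projective; (G3) $M$ is reflexive. For artin algebras, the conditions (G1), (G2) and (G3) are independent; that is, for each one of the three conditions there exist an artin algebra $A$ and a finitely generated left $A$-module $M$ which satisfies the other two conditions but not this one.
   Context: A left $A$-module $M$ is semi-Gorenstein-projective if $\operatorname{Ext}^i(M,{}_AA)=0$ for all $i\ge1$; a right $A$-module $N$ is semi-Gorenstein-projective if $\operatorname{Ext}^i(N,A_A)=0$ for all $i\ge1$. $M$ is reflexive if the canonical map $\phi_M\colon M\to M^{**}$, $\phi_M(m)(f)=f(m)$, is bijective. *)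

theory Defs
  imports "HOL-Algebra.Algebra"
begin

section \<open>Rings and modules\<close>

text \<open>
  The library locale \<open>module\<close> requires a commutative ring of scalars.  The locale below
  has the same axioms over an arbitrary ring.  As for \<open>module\<close>, the ring-multiplication and
  ring-unit fields of the record \<open>M\<close> play no role.
\<close>

locale left_module = R?: ring R + M?: abelian_group M
  for R :: "('a, 'n) ring_scheme" (structure)
    and M :: "('a, 'b, 'm) module_scheme" (structure) +
  assumes smult_closed [simp, intro]:
      "\<lbrakk>a \<in> carrier R; x \<in> carrier M\<rbrakk> \<Longrightarrow> a \<odot>\<^bsub>M\<^esub> x \<in> carrier M"
    and smult_l_distr:
      "\<lbrakk>a \<in> carrier R; b \<in> carrier R; x \<in> carrier M\<rbrakk> \<Longrightarrow>
        (a \<oplus>\<^bsub>R\<^esub> b) \<odot>\<^bsub>M\<^esub> x = a \<odot>\<^bsub>M\<^esub> x \<oplus>\<^bsub>M\<^esub> b \<odot>\<^bsub>M\<^esub> x"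
    and smult_r_distr:
      "\<lbrakk>a \<in> carrier R; x \<in> carrier M; y \<in> carrier M\<rbrakk> \<Longrightarrow>
        a \<odot>\<^bsub>M\<^esub> (x \<oplus>\<^bsub>M\<^esub> y) = a \<odot>\<^bsub>M\<^esub> x \<oplus>\<^bsub>M\<^esub> a \<odot>\<^bsub>M\<^esub> y"
    and smult_assoc1:
      "\<lbrakk>a \<in> carrier R; b \<in> carrier R; x \<in> carrier M\<rbrakk> \<Longrightarrow>
        (a \<otimes>\<^bsub>R\<^esub> b) \<odot>\<^bsub>M\<^esub> x = a \<odot>\<^bsub>M\<^esub> (b \<odot>\<^bsub>M\<^esub> x)"
    and smult_one [simp]:
      "x \<in> carrier M \<Longrightarrow> \<one>\<^bsub>R\<^esub> \<odot>\<^bsub>M\<^esub> x = x"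

definition finitely_generated ::
    "('a, 'n) ring_scheme \<Rightarrow> ('a, 'b, 'm) module_scheme \<Rightarrow> bool" where
  "finitely_generated R M \<longleftrightarrow>
     (\<exists>S. finite S \<and> S \<subseteq> carrier M \<and>
        (\<forall>x\<in>carrier M. \<exists>c\<in>S \<rightarrow> carrier R. x = (\<Oplus>\<^bsub>M\<^esub>s\<in>S. c s \<odot>\<^bsub>M\<^esub> s)))"

text \<open>Right \<open>R\<close>-modules are left modules over the opposite ring of \<open>R\<close>.\<close>

definition opposite :: "('a, 'n) ring_scheme \<Rightarrow> ('a, 'n) ring_scheme" where
  "opposite R = R\<lparr>monoid.mult := \<lambda>x y. y \<otimes>\<^bsub>R\<^esub> x\<rparr>"

text \<open>
  The left module \<open>R\<close> over itself; \<open>regular_module (opposite R)\<close> is \<open>R\<close> as a right module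
  over itself.
\<close>

definition regular_module :: "('a, 'n) ring_scheme \<Rightarrow> ('a, 'a) module" where
  "regular_module R =
     \<lparr>carrier = carrier R, monoid.mult = monoid.mult R, one = \<one>\<^bsub>R\<^esub>,
      ring.zero = \<zero>\<^bsub>R\<^esub>, add = add R, smult = monoid.mult R\<rparr>"

locale artinian_cring = cring R for R (structure) +
  assumes descending_chain:
    "\<lbrakk>\<And>n::nat. ideal (I n) R; \<And>n. I (Suc n) \<subseteq> I n\<rbrakk> \<Longrightarrow> \<exists>m. \<forall>n\<ge>m. I n = I m"

text \<open>
  An artin algebra: an associative unital algebra, not necessarily commutative, over a
  commutative artinian ring \<open>K\<close>, finitely generated as a \<open>K\<close>-module.  The field \<open>smult\<close> of the
  record \<open>A\<close> is the action of \<open>K\<close>.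
\<close>

locale artin_algebra = K?: artinian_cring K + A?: ring A + module K A
  for K :: "('k, 'n) ring_scheme" (structure) and A :: "('k, 'a, 'm) module_scheme" (structure) +
  assumes smult_mult_left:
      "\<lbrakk>k \<in> carrier K; x \<in> carrier A; y \<in> carrier A\<rbrakk> \<Longrightarrow>
        (k \<odot>\<^bsub>A\<^esub> x) \<otimes>\<^bsub>A\<^esub> y = k \<odot>\<^bsub>A\<^esub> (x \<otimes>\<^bsub>A\<^esub> y)"
    and smult_mult_right:
      "\<lbrakk>k \<in> carrier K; x \<in> carrier A; y \<in> carrier A\<rbrakk> \<Longrightarrow>
        x \<otimes>\<^bsub>A\<^esub> (k \<odot>\<^bsub>A\<^esub> y) = k \<odot>\<^bsub>A\<^esub> (x \<otimes>\<^bsub>A\<^esub> y)"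
    and finitely_generated: "finitely_generated K A"


section \<open>Homomorphisms, duals and reflexivity\<close>

text \<open>
  Homomorphisms are extensional functions, so that homomorphisms agreeing on
  \<open>carrier M\<close> are equal.
\<close>

definition module_homs ::
    "('a, 'n) ring_scheme \<Rightarrow> ('a, 'b, 'm) module_scheme \<Rightarrow> ('a, 'c, 'l) module_scheme
      \<Rightarrow> ('b \<Rightarrow> 'c) set" where
  "module_homs R M N =
     {f \<in> carrier M \<rightarrow>\<^sub>E carrier N.
        (\<forall>x\<in>carrier M. \<forall>y\<in>carrier M. f (x \<oplus>\<^bsub>M\<^esub> y) = f x \<oplus>\<^bsub>N\<^esub> f y) \<and>
        (\<forall>a\<in>carrier R. \<forall>x\<in>carrier M. f (a \<odot>\<^bsub>M\<^esub> x) = a \<odot>\<^bsub>N\<^esub> f x)}"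

text \<open>The abelian group \<open>Hom(M, N)\<close>, written as a multiplicative group.\<close>

definition hom_group ::
    "('a, 'n) ring_scheme \<Rightarrow> ('a, 'b, 'm) module_scheme \<Rightarrow> ('a, 'c, 'l) module_scheme
      \<Rightarrow> ('b \<Rightarrow> 'c) monoid" where
  "hom_group R M N =
     \<lparr>carrier = module_homs R M N,
      monoid.mult = (\<lambda>f g. \<lambda>x\<in>carrier M. f x \<oplus>\<^bsub>N\<^esub> g x),
      one = (\<lambda>x\<in>carrier M. \<zero>\<^bsub>N\<^esub>)\<rparr>"

text \<open>
  The dual \<open>Hom(M, R)\<close> of a left \<open>R\<close>-module \<open>M\<close>, with its right \<open>R\<close>-action
  \<open>(f a) m = (f m) a\<close>; it is thus a left module over \<open>opposite R\<close>.
\<close>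

definition dual ::
    "('a, 'n) ring_scheme \<Rightarrow> ('a, 'b, 'm) module_scheme \<Rightarrow> ('a, 'b \<Rightarrow> 'a) module" where
  "dual R M =
     \<lparr>carrier = module_homs R M (regular_module R), monoid.mult = undefined, one = undefined,
      ring.zero = (\<lambda>x\<in>carrier M. \<zero>\<^bsub>R\<^esub>),
      add = (\<lambda>f g. \<lambda>x\<in>carrier M. f x \<oplus>\<^bsub>R\<^esub> g x),
      smult = (\<lambda>a f. \<lambda>x\<in>carrier M. f x \<otimes>\<^bsub>R\<^esub> a)\<rparr>"

text \<open>
  The dual of a right \<open>R\<close>-module is the dual over \<open>opposite R\<close>, hence a left module over
  \<open>opposite (opposite R) = R\<close>.
\<close>

abbreviation bidual ::
    "('a, 'n) ring_scheme \<Rightarrow> ('a, 'b, 'm) module_scheme \<Rightarrow> ('a, ('b \<Rightarrow> 'a) \<Rightarrow> 'a) module" where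
  "bidual R M \<equiv> dual (opposite R) (dual R M)"

definition canonical_map ::
    "('a, 'n) ring_scheme \<Rightarrow> ('a, 'b, 'm) module_scheme \<Rightarrow> 'b \<Rightarrow> ('b \<Rightarrow> 'a) \<Rightarrow> 'a" where
  "canonical_map R M = (\<lambda>m. \<lambda>f\<in>carrier (dual R M). f m)"

definition reflexive ::
    "('a, 'n) ring_scheme \<Rightarrow> ('a, 'b, 'm) module_scheme \<Rightarrow> bool" where
  "reflexive R M \<longleftrightarrow> bij_betw (canonical_map R M) (carrier M) (carrier (bidual R M))"


section \<open>Ext\<close>

text \<open>The free left module \<open>R\<^sup>n\<close>.\<close>

definition free_module :: "('a, 'n) ring_scheme \<Rightarrow> nat \<Rightarrow> ('a, nat \<Rightarrow> 'a) module" where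
  "free_module R n =
     \<lparr>carrier = {..<n} \<rightarrow>\<^sub>E carrier R, monoid.mult = undefined, one = undefined,
      ring.zero = (\<lambda>i\<in>{..<n}. \<zero>\<^bsub>R\<^esub>),
      add = (\<lambda>x y. \<lambda>i\<in>{..<n}. x i \<oplus>\<^bsub>R\<^esub> y i),
      smult = (\<lambda>a x. \<lambda>i\<in>{..<n}. a \<otimes>\<^bsub>R\<^esub> x i)\<rparr>"

text \<open>
  A resolution of \<open>M\<close> by free modules of finite rank: an exact sequence
  \<open>\<dots> \<rightarrow> F 2 \<rightarrow> F 1 \<rightarrow> F 0 \<rightarrow> M \<rightarrow> 0\<close> with \<open>F i = R\<^bsup>r i\<^esup>\<close>, with maps
  \<open>d i : F (i + 1) \<rightarrow> F i\<close> and \<open>e : F 0 \<rightarrow> M\<close>.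
\<close>

definition free_resolution ::
    "('a, 'n) ring_scheme \<Rightarrow> ('a, 'b, 'm) module_scheme
      \<Rightarrow> (nat \<Rightarrow> nat) \<Rightarrow> (nat \<Rightarrow> (nat \<Rightarrow> 'a) \<Rightarrow> (nat \<Rightarrow> 'a)) \<Rightarrow> ((nat \<Rightarrow> 'a) \<Rightarrow> 'b) \<Rightarrow> bool" where
  "free_resolution R M r d e \<longleftrightarrow>
     (let F = (\<lambda>i. free_module R (r i)) in
        e \<in> module_homs R (F 0) M \<and>
        (\<forall>i. d i \<in> module_homs R (F (Suc i)) (F i)) \<and>
        e ` carrier (F 0) = carrier M \<and>
        d 0 ` carrier (F 1) = a_kernel (F 0) M e \<and>
        (\<forall>i. d (Suc i) ` carrier (F (Suc (Suc i))) = a_kernel (F (Suc i)) (F i) (d i)))"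

text \<open>
  The cocycles, coboundaries and cohomology groups of the complex obtained by deleting \<open>M\<close> and
  applying \<open>Hom(-, N)\<close>.
\<close>

definition ext_cocycles ::
    "('a, 'n) ring_scheme \<Rightarrow> (nat \<Rightarrow> nat) \<Rightarrow> (nat \<Rightarrow> (nat \<Rightarrow> 'a) \<Rightarrow> (nat \<Rightarrow> 'a))
      \<Rightarrow> ('a, 'c, 'l) module_scheme \<Rightarrow> nat \<Rightarrow> ((nat \<Rightarrow> 'a) \<Rightarrow> 'c) set" where
  "ext_cocycles R r d N i =
     {f \<in> module_homs R (free_module R (r i)) N.
        \<forall>x\<in>carrier (free_module R (r (Suc i))). f (d i x) = \<zero>\<^bsub>N\<^esub>}"

fun ext_coboundaries ::
    "('a, 'n) ring_scheme \<Rightarrow> (nat \<Rightarrow> nat) \<Rightarrow> (nat \<Rightarrow> (nat \<Rightarrow> 'a) \<Rightarrow> (nat \<Rightarrow> 'a))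
      \<Rightarrow> ('a, 'c, 'l) module_scheme \<Rightarrow> nat \<Rightarrow> ((nat \<Rightarrow> 'a) \<Rightarrow> 'c) set" where
  "ext_coboundaries R r d N 0 = {\<lambda>x\<in>carrier (free_module R (r 0)). \<zero>\<^bsub>N\<^esub>}"
| "ext_coboundaries R r d N (Suc i) =
     (\<lambda>g. compose (carrier (free_module R (r (Suc i)))) g (d i))
       ` module_homs R (free_module R (r i)) N"

definition ext_of_resolution ::
    "('a, 'n) ring_scheme \<Rightarrow> (nat \<Rightarrow> nat) \<Rightarrow> (nat \<Rightarrow> (nat \<Rightarrow> 'a) \<Rightarrow> (nat \<Rightarrow> 'a))
      \<Rightarrow> ('a, 'c, 'l) module_scheme \<Rightarrow> nat \<Rightarrow> ((nat \<Rightarrow> 'a) \<Rightarrow> 'c) set monoid" where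
  "ext_of_resolution R r d N i =
     (hom_group R (free_module R (r i)) N)\<lparr>carrier := ext_cocycles R r d N i\<rparr>
       Mod ext_coboundaries R r d N i"

text \<open>
  \<open>Ext\<^sup>i(M, N)\<close> is computed from a chosen resolution, and up to isomorphism it does not depend
  on the choice.  Resolutions of finite rank exist for all finitely generated modules over a
  noetherian ring, in particular for those over an artin algebra or its opposite; for other
  modules the definition is not meaningful.
\<close>

definition Ext ::
    "('a, 'n) ring_scheme \<Rightarrow> nat \<Rightarrow> ('a, 'b, 'm) module_scheme \<Rightarrow> ('a, 'c, 'l) module_scheme
      \<Rightarrow> ((nat \<Rightarrow> 'a) \<Rightarrow> 'c) set monoid" where
  "Ext R i M N =
     (let (r, d, e) = (SOME (r, d, e). free_resolution R M r d e) in ext_of_resolution R r d N i)"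

text \<open>For right \<open>R\<close>-modules, use this with \<open>opposite R\<close> in place of \<open>R\<close>.\<close>

definition semi_gorenstein_projective ::
    "('a, 'n) ring_scheme \<Rightarrow> ('a, 'b, 'm) module_scheme \<Rightarrow> bool" where
  "semi_gorenstein_projective R M \<longleftrightarrow>
     (\<forall>i\<ge>1. trivial_group (Ext R i M (regular_module R)))"


end

theory Submission
  imports Defs
begin

text \<open>
  All examples live over one algebra \<open>\<Lambda>\<close> of dimension six and over its opposite.  It is the rational
  algebra with basis \<open>1, x, y, z, yx, zx\<close> and relations
  \<open>x\<^sup>2 = y\<^sup>2 = z\<^sup>2 = yz = 0\<close>, \<open>xy = - q yx\<close>, \<open>xz = zy = zx\<close>; its radical has cube zero.  The
  parameter \<open>q\<close> must be nonzero and not a root of unity; \<open>q = 2\<close> is used at the end.  Put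
  \<open>\<omega>\<^sub>c = x - c y\<close>.  Everything follows from two computations of annihilators:

  \<^item> the right annihilator of \<open>\<omega>\<^bsub>qc\<^esub>\<close> is \<open>\<omega>\<^sub>c \<Lambda>\<close>, for every \<open>c\<close>;
  \<^item> the left annihilator of \<open>\<omega>\<^sub>c\<close> is \<open>\<Lambda> \<omega>\<^bsub>qc\<^esub>\<close> if \<open>c \<noteq> 1\<close> and \<open>q c \<noteq> 1\<close>, but \<open>z\<close> annihilates
    \<open>\<omega>\<^sub>1\<close> from the left and does not lie in \<open>\<Lambda> \<omega>\<^sub>q\<close>.

  Hence \<open>\<Lambda> / \<Lambda> \<omega>\<^sub>c\<close> has a resolution by copies of \<open>\<Lambda>\<close> in which the maps are the right
  multiplications by \<open>\<omega>\<^sub>c, \<omega>\<^bsub>qc\<^esub>, \<omega>\<^bsub>qqc\<^esub>, \<dots>\<close>, as long as the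
  parameter \<open>1\<close> is not met; the dual of this complex consists of left multiplications, and it is exact
  if each right annihilator is generated by the preceding element.  On the other side the parameters
  are divided by \<open>q\<close>.  Moreover, a homomorphism \<open>\<Lambda> / \<Lambda> \<omega>\<^sub>c \<rightarrow> \<Lambda>\<close> is an element of the right
  annihilator \<open>\<omega>\<^bsub>c/q\<^esub> \<Lambda>\<close>, so the dual of \<open>\<Lambda> / \<Lambda> \<omega>\<^sub>c\<close> is the cyclic right module
  \<open>\<Lambda> / \<omega>\<^bsub>c/qq\<^esub> \<Lambda>\<close>.  So passing to syzygies moves the parameter one step along the powers of
  \<open>q\<close>, upwards for left modules and downwards for right modules, dualising moves it two steps, and
  the only obstacle is the parameter \<open>1\<close> on the side where left annihilators are used:

  \<^item> \<open>c = q\<close>: the syzygies move away from \<open>1\<close>, and so do those of the dual, which starts at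
    \<open>1/q\<close>.  But all homomorphisms to \<open>\<Lambda>\<close> take values in \<open>\<omega>\<^sub>1 \<Lambda>\<close> on the generator, and these are
    killed by \<open>z\<close>; so the module is not reflexive.
  \<^item> \<open>c = q\<^sup>3\<close>: the dual is \<open>\<Lambda> / \<omega>\<^sub>q \<Lambda>\<close>, whose first syzygy meets \<open>1\<close>, and \<open>z\<close> gives a nonzero
    class in its first Ext group.  Dualising twice only uses the parameters \<open>q\<close>, \<open>q\<^sup>2\<close>,
    \<open>q\<^sup>3\<close>, and the module is reflexive.
  \<^item> That right module \<open>\<Lambda> / \<omega>\<^sub>q \<Lambda>\<close>, a left module over the opposite algebra, is reflexive with
    dual \<open>\<Lambda> / \<Lambda> \<omega>\<^bsub>qqq\<^esub>\<close>; so it violates the first condition only.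

  The Ext groups in question are defined by an arbitrary choice of resolution.  The theorem
  \<open>semi_gorenstein_projective_iff\<close>, a form of the comparison theorem, allows the resolutions above to be
  used.  The theorems \<open>cyclic_semi_gorenstein_projective_iff\<close>, \<open>dual_presented_by\<close>, \<open>cyclic_reflexive\<close>
  and \<open>cyclic_not_reflexive\<close> then reduce the three conditions to annihilators in an arbitrary ring.
\<close>

section \<open>Modules and their homomorphisms\<close>

lemma (in abelian_group) minus_eq_zero_iff:
  assumes "x \<in> carrier G" "y \<in> carrier G"
  shows "x \<ominus> y = \<zero> \<longleftrightarrow> x = y"
proof
  assume "x \<ominus> y = \<zero>"
  then have "\<ominus> (\<ominus> y) = x"
    using assms by (intro minus_equality) (simp_all add: a_minus_def)
  then show "x = y" using assms by simp
qed (use assms in \<open>simp add: a_minus_def r_neg\<close>)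

context left_module
begin

lemma smult_l_null [simp]:
  assumes "x \<in> carrier M"
  shows "\<zero>\<^bsub>R\<^esub> \<odot>\<^bsub>M\<^esub> x = \<zero>\<^bsub>M\<^esub>"
proof -
  have "\<zero>\<^bsub>R\<^esub> \<odot>\<^bsub>M\<^esub> x = \<zero>\<^bsub>R\<^esub> \<odot>\<^bsub>M\<^esub> x \<oplus>\<^bsub>M\<^esub> \<zero>\<^bsub>R\<^esub> \<odot>\<^bsub>M\<^esub> x"
    using smult_l_distr[of "\<zero>\<^bsub>R\<^esub>" "\<zero>\<^bsub>R\<^esub>" x] assms by simp
  then show ?thesis
    using assms by (metis M.add.l_cancel_one' R.zero_closed smult_closed)
qed

lemma smult_r_null [simp]:
  assumes "a \<in> carrier R"
  shows "a \<odot>\<^bsub>M\<^esub> \<zero>\<^bsub>M\<^esub> = \<zero>\<^bsub>M\<^esub>"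
proof -
  have "a \<odot>\<^bsub>M\<^esub> \<zero>\<^bsub>M\<^esub> = a \<odot>\<^bsub>M\<^esub> \<zero>\<^bsub>M\<^esub> \<oplus>\<^bsub>M\<^esub> a \<odot>\<^bsub>M\<^esub> \<zero>\<^bsub>M\<^esub>"
    using smult_r_distr[of a "\<zero>\<^bsub>M\<^esub>" "\<zero>\<^bsub>M\<^esub>"] assms by simp
  then show ?thesis
    using assms by (metis M.add.l_cancel_one' M.zero_closed smult_closed)
qed

lemma smult_l_minus:
  assumes "a \<in> carrier R" "x \<in> carrier M"
  shows "(\<ominus>\<^bsub>R\<^esub> a) \<odot>\<^bsub>M\<^esub> x = \<ominus>\<^bsub>M\<^esub> (a \<odot>\<^bsub>M\<^esub> x)"
proof -
  have "(\<ominus>\<^bsub>R\<^esub> a) \<odot>\<^bsub>M\<^esub> x \<oplus>\<^bsub>M\<^esub> a \<odot>\<^bsub>M\<^esub> x = \<zero>\<^bsub>M\<^esub>"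
    using smult_l_distr[of "\<ominus>\<^bsub>R\<^esub> a" a x] assms by (simp add: R.l_neg)
  then show ?thesis
    using assms by (metis M.minus_equality R.add.inv_closed smult_closed)
qed

lemma smult_r_minus:
  assumes "a \<in> carrier R" "x \<in> carrier M"
  shows "a \<odot>\<^bsub>M\<^esub> (\<ominus>\<^bsub>M\<^esub> x) = \<ominus>\<^bsub>M\<^esub> (a \<odot>\<^bsub>M\<^esub> x)"
proof -
  have "a \<odot>\<^bsub>M\<^esub> (\<ominus>\<^bsub>M\<^esub> x) \<oplus>\<^bsub>M\<^esub> a \<odot>\<^bsub>M\<^esub> x = \<zero>\<^bsub>M\<^esub>"
    using smult_r_distr[of a "\<ominus>\<^bsub>M\<^esub> x" x] assms by (simp add: M.l_neg)
  then show ?thesis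
    using assms by (metis M.minus_equality M.add.inv_closed smult_closed)
qed

lemma smult_finsum:
  assumes "finite S" "a \<in> carrier R" "g \<in> S \<rightarrow> carrier M"
  shows "a \<odot>\<^bsub>M\<^esub> (\<Oplus>\<^bsub>M\<^esub>i\<in>S. g i) = (\<Oplus>\<^bsub>M\<^esub>i\<in>S. a \<odot>\<^bsub>M\<^esub> g i)"
  using assms
proof (induction S)
  case (insert s S)
  then have "g \<in> S \<rightarrow> carrier M" "g s \<in> carrier M" by auto
  with insert show ?case
    by (simp add: Pi_iff smult_r_distr M.finsum_closed)
qed simp

end

lemma module_homsI:
  assumes "f \<in> carrier M \<rightarrow>\<^sub>E carrier N"
    and "\<And>x y. \<lbrakk>x \<in> carrier M; y \<in> carrier M\<rbrakk> \<Longrightarrow> f (x \<oplus>\<^bsub>M\<^esub> y) = f x \<oplus>\<^bsub>N\<^esub> f y"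
    and "\<And>a x. \<lbrakk>a \<in> carrier R; x \<in> carrier M\<rbrakk> \<Longrightarrow> f (a \<odot>\<^bsub>M\<^esub> x) = a \<odot>\<^bsub>N\<^esub> f x"
  shows "f \<in> module_homs R M N"
  using assms by (simp add: module_homs_def)

lemma module_homsD:
  assumes "f \<in> module_homs R M N"
  shows "f \<in> carrier M \<rightarrow>\<^sub>E carrier N"
    and "x \<in> carrier M \<Longrightarrow> f x \<in> carrier N"
    and "\<lbrakk>x \<in> carrier M; y \<in> carrier M\<rbrakk> \<Longrightarrow> f (x \<oplus>\<^bsub>M\<^esub> y) = f x \<oplus>\<^bsub>N\<^esub> f y"
    and "\<lbrakk>a \<in> carrier R; x \<in> carrier M\<rbrakk> \<Longrightarrow> f (a \<odot>\<^bsub>M\<^esub> x) = a \<odot>\<^bsub>N\<^esub> f x"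
  using assms by (auto simp: module_homs_def)

lemma module_homs_eqI:
  assumes "f \<in> module_homs R M N" "g \<in> module_homs R M N" "\<And>x. x \<in> carrier M \<Longrightarrow> f x = g x"
  shows "f = g"
  by (rule PiE_ext[OF module_homsD(1)[OF assms(1)] module_homsD(1)[OF assms(2)] assms(3)])

lemma module_homs_zero:
  assumes "left_module R M" "left_module R N" "f \<in> module_homs R M N"
  shows "f \<zero>\<^bsub>M\<^esub> = \<zero>\<^bsub>N\<^esub>"
proof -
  interpret M: left_module R M by fact
  interpret N: left_module R N by fact
  have "f (\<zero>\<^bsub>R\<^esub> \<odot>\<^bsub>M\<^esub> \<zero>\<^bsub>M\<^esub>) = \<zero>\<^bsub>R\<^esub> \<odot>\<^bsub>N\<^esub> f \<zero>\<^bsub>M\<^esub>"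
    by (rule module_homsD(4)[OF assms(3)]) auto
  then show ?thesis using module_homsD(2)[OF assms(3), of "\<zero>\<^bsub>M\<^esub>"] by simp
qed

lemma module_homs_minus:
  assumes "left_module R M" "left_module R N" "f \<in> module_homs R M N"
    and "x \<in> carrier M" "y \<in> carrier M"
  shows "f (x \<ominus>\<^bsub>M\<^esub> y) = f x \<ominus>\<^bsub>N\<^esub> f y"
proof -
  interpret M: left_module R M by fact
  interpret N: left_module R N by fact
  note f = module_homsD[OF assms(3)]
  have "f (\<ominus>\<^bsub>M\<^esub> y) \<oplus>\<^bsub>N\<^esub> f y = \<zero>\<^bsub>N\<^esub>"
    using f(3)[of "\<ominus>\<^bsub>M\<^esub> y" y] assms module_homs_zero[OF assms(1-3)] by (simp add: M.M.l_neg)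
  then have "f (\<ominus>\<^bsub>M\<^esub> y) = \<ominus>\<^bsub>N\<^esub> f y"
    using f(2) assms by (metis N.M.minus_equality M.M.a_inv_closed)
  then show ?thesis
    using f assms by (simp add: a_minus_def)
qed

lemma module_homs_add:
  assumes "left_module R M" "left_module R N" "f \<in> module_homs R M N" "g \<in> module_homs R M N"
  shows "(\<lambda>x\<in>carrier M. f x \<oplus>\<^bsub>N\<^esub> g x) \<in> module_homs R M N"
proof -
  interpret M: left_module R M by fact
  interpret N: left_module R N by fact
  note f = module_homsD[OF assms(3)] and g = module_homsD[OF assms(4)]
  show ?thesis
    by (rule module_homsI)
      (auto simp: f(2-4) g(2-4) N.smult_r_distr N.M.a_ac)
qed

lemma module_homs_uminus:
  assumes "left_module R M" "left_module R N" "f \<in> module_homs R M N"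
  shows "(\<lambda>x\<in>carrier M. \<ominus>\<^bsub>N\<^esub> f x) \<in> module_homs R M N"
proof -
  interpret M: left_module R M by fact
  interpret N: left_module R N by fact
  note f = module_homsD[OF assms(3)]
  show ?thesis
    by (rule module_homsI) (auto simp: f(2-4) N.smult_r_minus N.M.minus_add)
qed

lemma module_homs_diff:
  assumes "left_module R M" "left_module R N" "f \<in> module_homs R M N" "g \<in> module_homs R M N"
  shows "(\<lambda>x\<in>carrier M. f x \<ominus>\<^bsub>N\<^esub> g x) \<in> module_homs R M N"
  using module_homs_add[OF assms(1-3) module_homs_uminus[OF assms(1,2,4)]]
  by (simp add: a_minus_def restrict_def cong: if_cong)

lemma module_homs_const_zero:
  assumes "left_module R M" "left_module R N"
  shows "(\<lambda>x\<in>carrier M. \<zero>\<^bsub>N\<^esub>) \<in> module_homs R M N"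
proof -
  interpret M: left_module R M by fact
  interpret N: left_module R N by fact
  show ?thesis by (rule module_homsI) auto
qed

lemma module_homs_compose:
  assumes "left_module R L" "f \<in> module_homs R L M" "g \<in> module_homs R M N"
  shows "compose (carrier L) g f \<in> module_homs R L N"
proof -
  interpret L: left_module R L by fact
  note f = module_homsD[OF assms(2)] and g = module_homsD[OF assms(3)]
  show ?thesis
    by (rule module_homsI) (auto simp: compose_def f(2-4) g(2-4))
qed

lemma module_homs_id:
  assumes "left_module R M"
  shows "(\<lambda>x\<in>carrier M. x) \<in> module_homs R M M"
proof -
  interpret M: left_module R M by fact
  show ?thesis by (rule module_homsI) auto
qed

lemma left_module_regular_module:
  assumes "ring R"
  shows "left_module R (regular_module R)"
proof -
  interpret R: ring R by fact
  have "abelian_group (regular_module R)"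
    by (rule abelian_groupI) (auto simp: regular_module_def R.a_ac intro: R.l_neg R.add.inv_closed)
  then show ?thesis
    unfolding left_module_def left_module_axioms_def
    using R.ring_axioms by (auto simp: regular_module_def R.l_distr R.r_distr R.m_assoc)
qed

lemma left_module_free_module:
  assumes "ring R"
  shows "left_module R (free_module R n)"
proof -
  interpret R: ring R by fact
  have "abelian_group (free_module R n)"
  proof (rule abelian_groupI)
    fix x assume x: "x \<in> carrier (free_module R n)"
    then have "(\<lambda>i\<in>{..<n}. \<ominus>\<^bsub>R\<^esub> x i) \<in> carrier (free_module R n)"
      and "(\<lambda>i\<in>{..<n}. \<ominus>\<^bsub>R\<^esub> x i) \<oplus>\<^bsub>free_module R n\<^esub> x = \<zero>\<^bsub>free_module R n\<^esub>"
      by (auto simp: free_module_def PiE_iff R.l_neg intro!: restrict_ext)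
    then show "\<exists>y\<in>carrier (free_module R n). y \<oplus>\<^bsub>free_module R n\<^esub> x = \<zero>\<^bsub>free_module R n\<^esub>"
      by blast
  qed (auto simp: free_module_def PiE_iff extensional_def restrict_def R.a_ac fun_eq_iff)
  then show ?thesis
    unfolding left_module_def left_module_axioms_def
    using R.ring_axioms
    by (auto simp: free_module_def PiE_iff extensional_def restrict_def fun_eq_iff
        R.l_distr R.r_distr R.m_assoc)
qed

lemma opposite_sel [simp]:
  "carrier (opposite R) = carrier R" "x \<otimes>\<^bsub>opposite R\<^esub> y = y \<otimes>\<^bsub>R\<^esub> x" "\<one>\<^bsub>opposite R\<^esub> = \<one>\<^bsub>R\<^esub>"
  "\<zero>\<^bsub>opposite R\<^esub> = \<zero>\<^bsub>R\<^esub>" "x \<oplus>\<^bsub>opposite R\<^esub> y = x \<oplus>\<^bsub>R\<^esub> y"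
  by (simp_all add: opposite_def)

lemma opposite_opposite [simp]: "opposite (opposite R) = R"
  by (simp add: opposite_def)

lemma ring_opposite:
  assumes "ring R"
  shows "ring (opposite R)"
proof -
  interpret R: ring R by fact
  show ?thesis
  proof (rule ringI)
    show "abelian_group (opposite R)"
      by (rule abelian_groupI) (auto simp: R.a_ac intro: R.l_neg R.add.inv_closed)
    show "Group.monoid (opposite R)"
      by (rule monoidI) (auto simp: R.m_assoc)
  qed (auto simp: R.l_distr R.r_distr)
qed

lemma left_module_dual:
  assumes "left_module R M"
  shows "left_module (opposite R) (dual R M)"
proof -
  interpret M: left_module R M by fact
  have reg: "left_module R (regular_module R)"
    by (rule left_module_regular_module) (rule M.R.ring_axioms)
  have val: "f x \<in> carrier R" if "f \<in> carrier (dual R M)" "x \<in> carrier M" for f x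
    using that module_homsD(2)[of f R M "regular_module R"]
    by (simp add: dual_def regular_module_def)
  have ext: "f = g" if "f \<in> carrier (dual R M)" "g \<in> carrier (dual R M)"
    "\<And>x. x \<in> carrier M \<Longrightarrow> f x = g x" for f g
    using that module_homs_eqI[of f R M "regular_module R" g] by (simp add: dual_def)
  have add: "f \<oplus>\<^bsub>dual R M\<^esub> g \<in> carrier (dual R M)"
    if "f \<in> carrier (dual R M)" "g \<in> carrier (dual R M)" for f g
    using module_homs_add[OF assms reg, of f g] that by (simp add: dual_def regular_module_def)
  have zero: "\<zero>\<^bsub>dual R M\<^esub> \<in> carrier (dual R M)"
    using module_homs_const_zero[OF assms reg] by (simp add: dual_def regular_module_def)
  have smult: "a \<odot>\<^bsub>dual R M\<^esub> f \<in> carrier (dual R M)"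
    if "a \<in> carrier R" "f \<in> carrier (dual R M)" for a f
  proof -
    have f: "f \<in> module_homs R M (regular_module R)" using that by (simp add: dual_def)
    note f' = module_homsD[OF f]
    show ?thesis
      using that f'(2-4)
      by (auto simp: dual_def regular_module_def M.R.l_distr M.R.m_assoc intro!: module_homsI)
  qed
  have sel: "(f \<oplus>\<^bsub>dual R M\<^esub> g) x = f x \<oplus>\<^bsub>R\<^esub> g x" "\<zero>\<^bsub>dual R M\<^esub> x = \<zero>\<^bsub>R\<^esub>"
    "(a \<odot>\<^bsub>dual R M\<^esub> f) x = f x \<otimes>\<^bsub>R\<^esub> a" if "x \<in> carrier M" for f g a x
    using that by (simp_all add: dual_def)
  have grp: "abelian_group (dual R M)"
  proof (rule abelian_groupI)
    fix f assume f: "f \<in> carrier (dual R M)"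
    let ?g = "\<lambda>x\<in>carrier M. \<ominus>\<^bsub>regular_module R\<^esub> f x"
    have g: "?g \<in> carrier (dual R M)"
      using module_homs_uminus[OF assms reg, of f] f by (simp add: dual_def)
    have "\<ominus>\<^bsub>regular_module R\<^esub> a \<oplus>\<^bsub>R\<^esub> a = \<zero>\<^bsub>R\<^esub>" if "a \<in> carrier R" for a
      using abelian_group.l_neg[of "regular_module R" a] reg that
      by (auto simp: left_module_def regular_module_def)
    then have "?g \<oplus>\<^bsub>dual R M\<^esub> f = \<zero>\<^bsub>dual R M\<^esub>"
      by (intro ext add g f zero) (simp add: sel val f)
    with g show "\<exists>g\<in>carrier (dual R M). g \<oplus>\<^bsub>dual R M\<^esub> f = \<zero>\<^bsub>dual R M\<^esub>" by blast
  qed (auto intro!: ext add zero simp: sel val M.R.a_ac)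
  show ?thesis
    unfolding left_module_def left_module_axioms_def
    using grp ring_opposite[OF M.R.ring_axioms]
    by (auto intro!: ext add zero smult simp: sel val M.R.l_distr M.R.r_distr M.R.m_assoc)
qed

lemma finitely_generated_of_cyclic:
  assumes "left_module R M" "v \<in> carrier M" "(\<lambda>a. a \<odot>\<^bsub>M\<^esub> v) ` carrier R = carrier M"
  shows "finitely_generated R M"
proof -
  interpret M: left_module R M by fact
  have "\<exists>c\<in>{v} \<rightarrow> carrier R. x = (\<Oplus>\<^bsub>M\<^esub>s\<in>{v}. c s \<odot>\<^bsub>M\<^esub> s)" if x: "x \<in> carrier M" for x
  proof -
    from x assms(3) obtain a where "a \<in> carrier R" "x = a \<odot>\<^bsub>M\<^esub> v" by auto
    then show ?thesis using assms(2) by (intro bexI[of _ "\<lambda>_. a"]) auto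
  qed
  then show ?thesis
    unfolding finitely_generated_def using assms(2) by (intro exI[of _ "{v}"]) auto
qed

section \<open>Free modules are projective\<close>

definition unit_vector :: "('a, 'n) ring_scheme \<Rightarrow> nat \<Rightarrow> nat \<Rightarrow> nat \<Rightarrow> 'a" where
  "unit_vector R n i = (\<lambda>j\<in>{..<n}. if j = i then \<one>\<^bsub>R\<^esub> else \<zero>\<^bsub>R\<^esub>)"

lemma unit_vector_closed:
  assumes "ring R"
  shows "unit_vector R n i \<in> carrier (free_module R n)"
proof -
  interpret R: ring R by fact
  show ?thesis by (auto simp: unit_vector_def free_module_def)
qed

text \<open>
  The expansion in the standard basis is proved for the truncations of \<open>x\<close> to the first \<open>k\<close>
  coordinates, by induction on \<open>k\<close>.
\<close>

lemma free_module_hom_expand: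
  assumes "left_module R Y" "f \<in> module_homs R (free_module R n) Y"
    and x: "x \<in> carrier (free_module R n)"
  shows "f x = (\<Oplus>\<^bsub>Y\<^esub>i\<in>{..<n}. x i \<odot>\<^bsub>Y\<^esub> f (unit_vector R n i))"
proof -
  interpret Y: left_module R Y by fact
  have F: "left_module R (free_module R n)"
    by (rule left_module_free_module) (rule Y.R.ring_axioms)
  note f = module_homsD[OF assms(2)]
  let ?t = "\<lambda>k. \<lambda>i\<in>{..<n}. if i < k then x i else \<zero>\<^bsub>R\<^esub>"
  note uv = unit_vector_closed[OF Y.R.ring_axioms, of n]
  have t: "?t k \<in> carrier (free_module R n)" for k
    using x by (auto simp: free_module_def PiE_iff)
  have "f (?t k) = (\<Oplus>\<^bsub>Y\<^esub>i\<in>{..<k}. x i \<odot>\<^bsub>Y\<^esub> f (unit_vector R n i))" if "k \<le> n" for k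
    using that
  proof (induction k)
    case 0
    then show ?case
      using module_homs_zero[OF F assms(1,2)] by (simp add: free_module_def restrict_def)
  next
    case (Suc k)
    have xk: "x k \<in> carrier R" and xi: "\<And>i. i < Suc k \<Longrightarrow> x i \<in> carrier R"
      using x Suc.prems by (auto simp: free_module_def PiE_iff)
    have "?t (Suc k) = ?t k \<oplus>\<^bsub>free_module R n\<^esub> x k \<odot>\<^bsub>free_module R n\<^esub> unit_vector R n k"
      using x Suc.prems
      by (auto simp: free_module_def unit_vector_def PiE_iff fun_eq_iff restrict_def
          less_Suc_eq)
    moreover have "x k \<odot>\<^bsub>free_module R n\<^esub> unit_vector R n k \<in> carrier (free_module R n)"
      using left_module.smult_closed[OF F xk uv] .
    ultimately have "f (?t (Suc k)) = f (?t k) \<oplus>\<^bsub>Y\<^esub> x k \<odot>\<^bsub>Y\<^esub> f (unit_vector R n k)"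
      using f(3)[OF t] f(4)[OF xk uv] by simp
    also have "\<dots> = (\<Oplus>\<^bsub>Y\<^esub>i\<in>{..<Suc k}. x i \<odot>\<^bsub>Y\<^esub> f (unit_vector R n i))"
    proof -
      have "(\<lambda>i. x i \<odot>\<^bsub>Y\<^esub> f (unit_vector R n i)) \<in> {..<k} \<rightarrow> carrier Y"
        using xi f(2)[OF uv] by auto
      moreover have "f (?t k) = (\<Oplus>\<^bsub>Y\<^esub>i\<in>{..<k}. x i \<odot>\<^bsub>Y\<^esub> f (unit_vector R n i))"
        using Suc.prems by (intro Suc.IH) simp
      ultimately show ?thesis
        unfolding \<open>f (?t k) = _\<close>
        using xk f(2)[OF uv] by (simp add: lessThan_Suc Y.M.a_comm Y.M.finsum_closed)
    qed
    finally show ?case .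
  qed
  from this[of n] have "f (?t n) = (\<Oplus>\<^bsub>Y\<^esub>i\<in>{..<n}. x i \<odot>\<^bsub>Y\<^esub> f (unit_vector R n i))" by simp
  moreover have "?t n = x"
    using x by (auto simp: free_module_def PiE_iff fun_eq_iff restrict_def extensional_def)
  ultimately show ?thesis by (simp only:)
qed

lemma free_module_linear_combination_hom:
  assumes "left_module R U" "t \<in> {..<n} \<rightarrow> carrier U"
  shows "(\<lambda>x\<in>carrier (free_module R n). (\<Oplus>\<^bsub>U\<^esub>i\<in>{..<n}. x i \<odot>\<^bsub>U\<^esub> t i))
    \<in> module_homs R (free_module R n) U"
proof -
  interpret U: left_module R U by fact
  interpret F: left_module R "free_module R n"
    by (rule left_module_free_module) (rule U.R.ring_axioms)
  have c: "x i \<in> carrier R" if "x \<in> carrier (free_module R n)" "i < n" for x i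
    using that by (auto simp: free_module_def)
  have t: "t i \<in> carrier U" if "i < n" for i using that assms(2) by auto
  show ?thesis
  proof (rule module_homsI)
    fix x y assume xy: "x \<in> carrier (free_module R n)" "y \<in> carrier (free_module R n)"
    have "(\<Oplus>\<^bsub>U\<^esub>i\<in>{..<n}. (x \<oplus>\<^bsub>free_module R n\<^esub> y) i \<odot>\<^bsub>U\<^esub> t i)
        = (\<Oplus>\<^bsub>U\<^esub>i\<in>{..<n}. x i \<odot>\<^bsub>U\<^esub> t i \<oplus>\<^bsub>U\<^esub> y i \<odot>\<^bsub>U\<^esub> t i)"
      using xy c t by (intro U.M.finsum_cong') (auto simp: free_module_def U.smult_l_distr)
    also have "\<dots> = (\<Oplus>\<^bsub>U\<^esub>i\<in>{..<n}. x i \<odot>\<^bsub>U\<^esub> t i) \<oplus>\<^bsub>U\<^esub> (\<Oplus>\<^bsub>U\<^esub>i\<in>{..<n}. y i \<odot>\<^bsub>U\<^esub> t i)"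
      using xy c t by (intro U.M.finsum_addf) auto
    finally show "(\<lambda>x\<in>carrier (free_module R n). (\<Oplus>\<^bsub>U\<^esub>i\<in>{..<n}. x i \<odot>\<^bsub>U\<^esub> t i))
         (x \<oplus>\<^bsub>free_module R n\<^esub> y) =
        (\<lambda>x\<in>carrier (free_module R n). (\<Oplus>\<^bsub>U\<^esub>i\<in>{..<n}. x i \<odot>\<^bsub>U\<^esub> t i)) x \<oplus>\<^bsub>U\<^esub>
        (\<lambda>x\<in>carrier (free_module R n). (\<Oplus>\<^bsub>U\<^esub>i\<in>{..<n}. x i \<odot>\<^bsub>U\<^esub> t i)) y"
      using xy by simp
  next
    fix a x assume ax: "a \<in> carrier R" "x \<in> carrier (free_module R n)"
    have "(\<Oplus>\<^bsub>U\<^esub>i\<in>{..<n}. (a \<odot>\<^bsub>free_module R n\<^esub> x) i \<odot>\<^bsub>U\<^esub> t i)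
        = (\<Oplus>\<^bsub>U\<^esub>i\<in>{..<n}. a \<odot>\<^bsub>U\<^esub> (x i \<odot>\<^bsub>U\<^esub> t i))"
      using ax c t by (intro U.M.finsum_cong') (auto simp: free_module_def U.smult_assoc1)
    also have "\<dots> = a \<odot>\<^bsub>U\<^esub> (\<Oplus>\<^bsub>U\<^esub>i\<in>{..<n}. x i \<odot>\<^bsub>U\<^esub> t i)"
      using ax c t by (intro U.smult_finsum[symmetric]) auto
    finally show "(\<lambda>x\<in>carrier (free_module R n). (\<Oplus>\<^bsub>U\<^esub>i\<in>{..<n}. x i \<odot>\<^bsub>U\<^esub> t i))
         (a \<odot>\<^bsub>free_module R n\<^esub> x) =
        a \<odot>\<^bsub>U\<^esub> (\<lambda>x\<in>carrier (free_module R n). (\<Oplus>\<^bsub>U\<^esub>i\<in>{..<n}. x i \<odot>\<^bsub>U\<^esub> t i)) x"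
      using ax by simp
  qed (use c t in \<open>auto intro!: U.M.finsum_closed\<close>)
qed

text \<open>
  Projectivity: lift the images of the unit vectors and extend linearly.  Below, \<open>g\<close> is an
  augmentation or a differential, and \<open>f\<close> takes values in its image by exactness.
\<close>

lemma free_module_lift:
  assumes U: "left_module R U" and Y: "left_module R Y"
    and f: "f \<in> module_homs R (free_module R n) Y" and g: "g \<in> module_homs R U Y"
    and sub: "f ` carrier (free_module R n) \<subseteq> g ` carrier U"
  obtains h where "h \<in> module_homs R (free_module R n) U"
    "\<And>x. x \<in> carrier (free_module R n) \<Longrightarrow> g (h x) = f x"
proof -
  interpret U: left_module R U by fact
  let ?F = "free_module R n"
  have F: "left_module R ?F"
    by (rule left_module_free_module) (rule U.R.ring_axioms)
  note uv = unit_vector_closed[OF U.R.ring_axioms, of n]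
  have "\<forall>i. \<exists>s. s \<in> carrier U \<and> g s = f (unit_vector R n i)"
    using sub uv by (metis (no_types, lifting) imageE image_subset_iff)
  then obtain t where t: "\<And>i. t i \<in> carrier U" "\<And>i. g (t i) = f (unit_vector R n i)"
    by metis
  define h where "h = (\<lambda>x\<in>carrier ?F. (\<Oplus>\<^bsub>U\<^esub>i\<in>{..<n}. x i \<odot>\<^bsub>U\<^esub> t i))"
  have h: "h \<in> module_homs R ?F U"
    unfolding h_def using t by (intro free_module_linear_combination_hom U) auto
  have hu: "h (unit_vector R n i) = t i" if "i < n" for i
  proof -
    have "h (unit_vector R n i) = (\<Oplus>\<^bsub>U\<^esub>j\<in>{..<n}. if j = i then t j else \<zero>\<^bsub>U\<^esub>)"
      unfolding h_def using uv t
      by (auto simp: unit_vector_def intro!: U.M.finsum_cong')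
    also have "\<dots> = t i"
      using U.M.finsum_singleton[of i "{..<n}" t] that t
      by (simp add: eq_commute[of i] cong: if_cong)
    finally show ?thesis .
  qed
  have "g (h x) = f x" if x: "x \<in> carrier ?F" for x
  proof -
    have "g (h x) = compose (carrier ?F) g h x" using x by (simp add: compose_def)
    also have "\<dots> = (\<Oplus>\<^bsub>Y\<^esub>i\<in>{..<n}. x i \<odot>\<^bsub>Y\<^esub> compose (carrier ?F) g h (unit_vector R n i))"
      by (rule free_module_hom_expand[OF Y module_homs_compose[OF F h g] x])
    also have "\<dots> = (\<Oplus>\<^bsub>Y\<^esub>i\<in>{..<n}. x i \<odot>\<^bsub>Y\<^esub> f (unit_vector R n i))"
    proof -
      interpret Y: left_module R Y by fact
      have "x i \<in> carrier R" if "i < n" for i using x that by (auto simp: free_module_def)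
      then show ?thesis
        using uv t hu module_homsD(2)[OF f uv]
        by (intro Y.M.finsum_cong') (auto simp: compose_def)
    qed
    also have "\<dots> = f x" by (rule free_module_hom_expand[OF Y f x, symmetric])
    finally show ?thesis .
  qed
  with h show ?thesis by (rule that)
qed

section \<open>Ext does not depend on the resolution\<close>

lemma free_resolutionD:
  assumes "free_resolution R M r d e"
  shows "e \<in> module_homs R (free_module R (r 0)) M"
    and "d i \<in> module_homs R (free_module R (r (Suc i))) (free_module R (r i))"
    and "e ` carrier (free_module R (r 0)) = carrier M"
    and "y \<in> d 0 ` carrier (free_module R (r (Suc 0)))
      \<longleftrightarrow> y \<in> carrier (free_module R (r 0)) \<and> e y = \<zero>\<^bsub>M\<^esub>"
    and "z \<in> d (Suc i) ` carrier (free_module R (r (Suc (Suc i))))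
      \<longleftrightarrow> z \<in> carrier (free_module R (r (Suc i))) \<and> d i z = \<zero>\<^bsub>free_module R (r i)\<^esub>"
  using assms
  by (auto simp: free_resolution_def Let_def a_kernel_def' image_iff)

text \<open>
  A chain homotopy equivalence of two resolutions, reduced to what an induction on the degree needs.
  Here \<open>\<phi>\<close> and \<open>\<psi>\<close> are the components in degree \<open>n\<close> of chain maps in both directions, and they are only
  required to respect the images of the next differentials, which are the cycles.  The map \<open>k\<close> stands for
  the part of the homotopy formula that factors through the differential leaving degree \<open>n\<close>; that it
  vanishes on the cycles is all that the next step needs, and it lets degree \<open>0\<close>, where \<open>k = 0\<close>, be treated
  like the others.  Working in one degree at a time makes the choice of infinite sequences of maps
  superfluous.
\<close>

definition comparable_at where
  "comparable_at R r d r' d' n \<longleftrightarrow>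
    (\<exists>\<phi> \<in> module_homs R (free_module R (r n)) (free_module R (r' n)).
     \<exists>\<psi> \<in> module_homs R (free_module R (r' n)) (free_module R (r n)).
     \<exists>k \<in> module_homs R (free_module R (r' n)) (free_module R (r' n)).
       \<phi> ` d n ` carrier (free_module R (r (Suc n))) \<subseteq> d' n ` carrier (free_module R (r' (Suc n))) \<and>
       \<psi> ` d' n ` carrier (free_module R (r' (Suc n))) \<subseteq> d n ` carrier (free_module R (r (Suc n))) \<and>
       (\<forall>y\<in>d' n ` carrier (free_module R (r' (Suc n))). k y = \<zero>\<^bsub>free_module R (r' n)\<^esub>) \<and>
       (\<forall>y\<in>carrier (free_module R (r' n)).
          y \<ominus>\<^bsub>free_module R (r' n)\<^esub> (\<phi> (\<psi> y) \<oplus>\<^bsub>free_module R (r' n)\<^esub> k y)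
            \<in> d' n ` carrier (free_module R (r' (Suc n)))))"

text \<open>
  Both augmentations are onto, so each can be lifted along the other.
\<close>

lemma comparable_at_0:
  assumes M: "left_module R M" and P: "free_resolution R M r d e" and P': "free_resolution R M r' d' e'"
  shows "comparable_at R r d r' d' 0"
proof -
  interpret M: left_module R M by fact
  note ring = M.R.ring_axioms
  let ?F = "free_module R (r 0)" and ?F' = "free_module R (r' 0)"
  note F = left_module_free_module[OF ring, of "r 0"]
    and F' = left_module_free_module[OF ring, of "r' 0"]
  interpret F': left_module R ?F' by fact
  note p = free_resolutionD[OF P] and p' = free_resolutionD[OF P']
  obtain \<phi> where \<phi>: "\<phi> \<in> module_homs R ?F ?F'" "\<And>x. x \<in> carrier ?F \<Longrightarrow> e' (\<phi> x) = e x"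
    using free_module_lift[OF F' M p(1) p'(1)] p(3) p'(3) by auto
  obtain \<psi> where \<psi>: "\<psi> \<in> module_homs R ?F' ?F" "\<And>x. x \<in> carrier ?F' \<Longrightarrow> e (\<psi> x) = e' x"
    using free_module_lift[OF F M p'(1) p(1)] p(3) p'(3) by auto
  have k: "(\<lambda>y\<in>carrier ?F'. \<zero>\<^bsub>?F'\<^esub>) \<in> module_homs R ?F' ?F'"
    by (rule module_homs_const_zero[OF F' F'])
  show ?thesis
    unfolding comparable_at_def
  proof (rule bexI[OF _ \<phi>(1)], rule bexI[OF _ \<psi>(1)], rule bexI[OF _ k], intro conjI ballI)
    show "\<phi> ` d 0 ` carrier (free_module R (r (Suc 0))) \<subseteq> d' 0 ` carrier (free_module R (r' (Suc 0)))"
      using p(4) p'(4) \<phi>(2) module_homsD(2)[OF \<phi>(1)] by (intro image_subsetI) simp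
    show "\<psi> ` d' 0 ` carrier (free_module R (r' (Suc 0))) \<subseteq> d 0 ` carrier (free_module R (r (Suc 0)))"
      using p(4) p'(4) \<psi>(2) module_homsD(2)[OF \<psi>(1)] by (intro image_subsetI) simp
  next
    fix y assume "y \<in> d' 0 ` carrier (free_module R (r' (Suc 0)))"
    then show "(\<lambda>y\<in>carrier ?F'. \<zero>\<^bsub>?F'\<^esub>) y = \<zero>\<^bsub>?F'\<^esub>" using p'(4) by simp
  next
    fix y assume y: "y \<in> carrier ?F'"
    have c: "\<psi> y \<in> carrier ?F" "\<phi> (\<psi> y) \<in> carrier ?F'" "e' y \<in> carrier M"
      using module_homsD(2)[OF \<phi>(1)] module_homsD(2)[OF \<psi>(1)] module_homsD(2)[OF p'(1)] y by auto
    have "e' (y \<ominus>\<^bsub>?F'\<^esub> \<phi> (\<psi> y)) = \<zero>\<^bsub>M\<^esub>"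
      using module_homs_minus[OF F' M p'(1) y c(2)] \<phi>(2)[OF c(1)] \<psi>(2)[OF y] c(3)
      by (simp add: a_minus_def M.M.r_neg)
    then show "y \<ominus>\<^bsub>?F'\<^esub> (\<phi> (\<psi> y) \<oplus>\<^bsub>?F'\<^esub> (\<lambda>y\<in>carrier ?F'. \<zero>\<^bsub>?F'\<^esub>) y)
      \<in> d' 0 ` carrier (free_module R (r' (Suc 0)))"
      using p'(4) y c by simp
  qed
qed

text \<open>
  The maps \<open>\<phi>\<close> and \<open>\<psi>\<close> are lifted along the differentials.  The difference of the identity and
  \<open>\<phi> \<psi> + k\<close> takes values in the image of \<open>d' n\<close>, so it also lifts; the lift \<open>h\<close> is the homotopy.
\<close>

lemma comparable_at_step:
  assumes M: "left_module R M" and P: "free_resolution R M r d e" and P': "free_resolution R M r' d' e'"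
    and cmp: "comparable_at R r d r' d' n"
  obtains \<phi> \<psi> \<phi>' \<psi>' h where
    "\<phi> \<in> module_homs R (free_module R (r n)) (free_module R (r' n))"
    "\<psi> \<in> module_homs R (free_module R (r' n)) (free_module R (r n))"
    "\<phi>' \<in> module_homs R (free_module R (r (Suc n))) (free_module R (r' (Suc n)))"
    "\<psi>' \<in> module_homs R (free_module R (r' (Suc n))) (free_module R (r (Suc n)))"
    "h \<in> module_homs R (free_module R (r' n)) (free_module R (r' (Suc n)))"
    "\<And>x. x \<in> carrier (free_module R (r (Suc n))) \<Longrightarrow> d' n (\<phi>' x) = \<phi> (d n x)"
    "\<And>y. y \<in> carrier (free_module R (r' (Suc n))) \<Longrightarrow> d n (\<psi>' y) = \<psi> (d' n y)"
    "\<And>y. y \<in> carrier (free_module R (r' (Suc n))) \<Longrightarrow>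
      y \<ominus>\<^bsub>free_module R (r' (Suc n))\<^esub> (\<phi>' (\<psi>' y) \<oplus>\<^bsub>free_module R (r' (Suc n))\<^esub> h (d' n y))
        \<in> d' (Suc n) ` carrier (free_module R (r' (Suc (Suc n))))"
proof -
  interpret M: left_module R M by fact
  note ring = M.R.ring_axioms
  let ?F = "free_module R (r n)" and ?F' = "free_module R (r' n)"
  let ?G = "free_module R (r (Suc n))" and ?G' = "free_module R (r' (Suc n))"
  note F = left_module_free_module[OF ring, of "r n"]
    and F' = left_module_free_module[OF ring, of "r' n"]
    and G = left_module_free_module[OF ring, of "r (Suc n)"]
    and G' = left_module_free_module[OF ring, of "r' (Suc n)"]
  interpret F': left_module R ?F' by fact
  interpret G': left_module R ?G' by fact
  note d = free_resolutionD(2)[OF P, of n] and d' = free_resolutionD(2)[OF P', of n]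
  note ex' = free_resolutionD(5)[OF P', of _ n]
  from cmp obtain \<phi> \<psi> k where
    \<phi>: "\<phi> \<in> module_homs R ?F ?F'" and \<psi>: "\<psi> \<in> module_homs R ?F' ?F" and k: "k \<in> module_homs R ?F' ?F'"
    and \<phi>Z: "\<phi> ` d n ` carrier ?G \<subseteq> d' n ` carrier ?G'"
    and \<psi>Z: "\<psi> ` d' n ` carrier ?G' \<subseteq> d n ` carrier ?G"
    and kZ: "\<And>y. y \<in> carrier ?G' \<Longrightarrow> k (d' n y) = \<zero>\<^bsub>?F'\<^esub>"
    and id: "\<And>y. y \<in> carrier ?F' \<Longrightarrow> y \<ominus>\<^bsub>?F'\<^esub> (\<phi> (\<psi> y) \<oplus>\<^bsub>?F'\<^esub> k y) \<in> d' n ` carrier ?G'"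
    unfolding comparable_at_def by auto
  have "compose (carrier ?G) \<phi> (d n) ` carrier ?G \<subseteq> d' n ` carrier ?G'"
    using \<phi>Z by (auto simp: compose_def)
  from free_module_lift[OF G' F' module_homs_compose[OF G d \<phi>] d' this]
  obtain \<phi>' where \<phi>': "\<phi>' \<in> module_homs R ?G ?G'" "\<And>x. x \<in> carrier ?G \<Longrightarrow> d' n (\<phi>' x) = \<phi> (d n x)"
    by (metis compose_eq)
  have "compose (carrier ?G') \<psi> (d' n) ` carrier ?G' \<subseteq> d n ` carrier ?G"
    using \<psi>Z by (auto simp: compose_def)
  from free_module_lift[OF G F module_homs_compose[OF G' d' \<psi>] d this]
  obtain \<psi>' where \<psi>': "\<psi>' \<in> module_homs R ?G' ?G" "\<And>x. x \<in> carrier ?G' \<Longrightarrow> d n (\<psi>' x) = \<psi> (d' n x)"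
    by (metis compose_eq)
  define \<theta> where "\<theta> = (\<lambda>y\<in>carrier ?F'. (\<lambda>y\<in>carrier ?F'. y) y \<ominus>\<^bsub>?F'\<^esub>
      (\<lambda>y\<in>carrier ?F'. compose (carrier ?F') \<phi> \<psi> y \<oplus>\<^bsub>?F'\<^esub> k y) y)"
  have \<theta>: "\<theta> \<in> module_homs R ?F' ?F'"
    unfolding \<theta>_def
    by (intro module_homs_diff[OF F' F'] module_homs_id[OF F'] module_homs_add[OF F' F'] k
        module_homs_compose[OF F' \<psi> \<phi>])
  have \<theta>_eq: "\<theta> y = y \<ominus>\<^bsub>?F'\<^esub> (\<phi> (\<psi> y) \<oplus>\<^bsub>?F'\<^esub> k y)" if "y \<in> carrier ?F'" for y
    using that by (simp add: \<theta>_def compose_def)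
  have "\<theta> ` carrier ?F' \<subseteq> d' n ` carrier ?G'" using id by (auto simp: \<theta>_eq)
  from free_module_lift[OF G' F' \<theta> d' this]
  obtain h where h: "h \<in> module_homs R ?F' ?G'" "\<And>y. y \<in> carrier ?F' \<Longrightarrow> d' n (h y) = \<theta> y" by blast
  have "y \<ominus>\<^bsub>?G'\<^esub> (\<phi>' (\<psi>' y) \<oplus>\<^bsub>?G'\<^esub> h (d' n y)) \<in> d' (Suc n) ` carrier (free_module R (r' (Suc (Suc n))))"
    if y: "y \<in> carrier ?G'" for y
  proof -
    note [simp] = module_homsD(2)[OF \<phi>] module_homsD(2)[OF \<psi>] module_homsD(2)[OF \<phi>'(1)]
      module_homsD(2)[OF \<psi>'(1)] module_homsD(2)[OF h(1)] module_homsD(2)[OF d'] module_homsD(2)[OF d] y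
    have "d' n (y \<ominus>\<^bsub>?G'\<^esub> (\<phi>' (\<psi>' y) \<oplus>\<^bsub>?G'\<^esub> h (d' n y)))
        = d' n y \<ominus>\<^bsub>?F'\<^esub> (d' n (\<phi>' (\<psi>' y)) \<oplus>\<^bsub>?F'\<^esub> d' n (h (d' n y)))"
      by (simp add: module_homs_minus[OF G' F' d'] module_homsD(3)[OF d'])
    also have "\<dots> = d' n y \<ominus>\<^bsub>?F'\<^esub> (\<phi> (\<psi> (d' n y)) \<oplus>\<^bsub>?F'\<^esub> (d' n y \<ominus>\<^bsub>?F'\<^esub> \<phi> (\<psi> (d' n y))))"
      by (simp add: \<phi>'(2) \<psi>'(2) h(2) \<theta>_eq kZ)
    also have "\<dots> = \<zero>\<^bsub>?F'\<^esub>"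
    proof -
      have "a \<ominus>\<^bsub>?F'\<^esub> (b \<oplus>\<^bsub>?F'\<^esub> (a \<ominus>\<^bsub>?F'\<^esub> b)) = \<zero>\<^bsub>?F'\<^esub>"
        if "a \<in> carrier ?F'" "b \<in> carrier ?F'" for a b
        using that by (simp add: a_minus_def F'.M.a_lcomm[of b a] F'.M.r_neg)
      then show ?thesis by simp
    qed
    finally show ?thesis by (simp add: ex')
  qed
  from that[OF \<phi> \<psi> \<phi>'(1) \<psi>'(1) h(1) \<phi>'(2) \<psi>'(2) this] show ?thesis by blast
qed

lemma comparable_at_all:
  assumes M: "left_module R M" and P: "free_resolution R M r d e" and P': "free_resolution R M r' d' e'"
  shows "comparable_at R r d r' d' n"
proof (induction n)
  case 0
  show ?case by (rule comparable_at_0[OF assms])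
next
  case (Suc n)
  interpret M: left_module R M by fact
  let ?F' = "free_module R (r' n)"
  let ?G = "free_module R (r (Suc n))" and ?G' = "free_module R (r' (Suc n))"
  note ring = M.R.ring_axioms
  note F = left_module_free_module[OF ring, of "r n"]
    and F' = left_module_free_module[OF ring, of "r' n"]
    and G' = left_module_free_module[OF ring, of "r' (Suc n)"]
  note d' = free_resolutionD(2)[OF P', of n]
  note ex = free_resolutionD(5)[OF P, of _ n] and ex' = free_resolutionD(5)[OF P', of _ n]
  from comparable_at_step[OF assms Suc.IH] obtain \<phi> \<psi> \<phi>' \<psi>' h where
    \<phi>: "\<phi> \<in> module_homs R (free_module R (r n)) ?F'"
    and \<psi>: "\<psi> \<in> module_homs R ?F' (free_module R (r n))"
    and \<phi>': "\<phi>' \<in> module_homs R ?G ?G'" "\<And>x. x \<in> carrier ?G \<Longrightarrow> d' n (\<phi>' x) = \<phi> (d n x)"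
    and \<psi>': "\<psi>' \<in> module_homs R ?G' ?G" "\<And>y. y \<in> carrier ?G' \<Longrightarrow> d n (\<psi>' y) = \<psi> (d' n y)"
    and h: "h \<in> module_homs R ?F' ?G'"
    and id: "\<And>y. y \<in> carrier ?G' \<Longrightarrow> y \<ominus>\<^bsub>?G'\<^esub> (\<phi>' (\<psi>' y) \<oplus>\<^bsub>?G'\<^esub> h (d' n y))
      \<in> d' (Suc n) ` carrier (free_module R (r' (Suc (Suc n))))"
    by metis
  note k = module_homs_compose[OF G' d' h]
  show ?case
    unfolding comparable_at_def
  proof (rule bexI[OF _ \<phi>'(1)], rule bexI[OF _ \<psi>'(1)], rule bexI[OF _ k], intro conjI ballI)
    show "\<phi>' ` d (Suc n) ` carrier (free_module R (r (Suc (Suc n))))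
        \<subseteq> d' (Suc n) ` carrier (free_module R (r' (Suc (Suc n))))"
      using ex ex' \<phi>'(2) module_homsD(2)[OF \<phi>'(1)] module_homs_zero[OF F F' \<phi>]
      by (intro image_subsetI) simp
    show "\<psi>' ` d' (Suc n) ` carrier (free_module R (r' (Suc (Suc n))))
        \<subseteq> d (Suc n) ` carrier (free_module R (r (Suc (Suc n))))"
      using ex ex' \<psi>'(2) module_homsD(2)[OF \<psi>'(1)] module_homs_zero[OF F' F \<psi>]
      by (intro image_subsetI) simp
  next
    fix y assume "y \<in> d' (Suc n) ` carrier (free_module R (r' (Suc (Suc n))))"
    then show "compose (carrier ?G') h (d' n) y = \<zero>\<^bsub>?G'\<^esub>"
      using ex' module_homs_zero[OF F' G' h] by (simp add: compose_def)
  next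
    fix y assume "y \<in> carrier ?G'"
    then show "y \<ominus>\<^bsub>?G'\<^esub> (\<phi>' (\<psi>' y) \<oplus>\<^bsub>?G'\<^esub> compose (carrier ?G') h (d' n) y)
      \<in> d' (Suc n) ` carrier (free_module R (r' (Suc (Suc n))))"
      using id by (simp add: compose_def)
  qed
qed

text \<open>
  A cocycle \<open>f\<close> kills the last term of the homotopy formula, so that
  \<open>f = f \<phi>' \<psi>' + f h d'\<close>.  The second summand is a coboundary, and so is the first:
  \<open>f \<phi>'\<close> is a cocycle of the other complex, thus equal to some \<open>g d\<close>, and
  \<open>g d \<psi>' = g \<psi> d'\<close>.
\<close>

lemma exactness_transfer:
  assumes M: "left_module R M" and N: "left_module R N"
    and P: "free_resolution R M r d e" and P': "free_resolution R M r' d' e'"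
    and exact: "ext_cocycles R r d N (Suc n) \<subseteq> ext_coboundaries R r d N (Suc n)"
  shows "ext_cocycles R r' d' N (Suc n) \<subseteq> ext_coboundaries R r' d' N (Suc n)"
proof
  interpret M: left_module R M by fact
  interpret N: left_module R N by fact
  let ?F = "free_module R (r n)" and ?F' = "free_module R (r' n)"
  let ?G = "free_module R (r (Suc n))" and ?G' = "free_module R (r' (Suc n))"
  note ring = M.R.ring_axioms
  note F = left_module_free_module[OF ring, of "r n"]
    and F' = left_module_free_module[OF ring, of "r' n"]
    and G = left_module_free_module[OF ring, of "r (Suc n)"]
    and G' = left_module_free_module[OF ring, of "r' (Suc n)"]
  interpret G': left_module R ?G' by fact
  note d = free_resolutionD(2)[OF P] and d' = free_resolutionD(2)[OF P']
  note ex = free_resolutionD(5)[OF P, of _ n] and ex' = free_resolutionD(5)[OF P', of _ n]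
  from comparable_at_step[OF M P P' comparable_at_all[OF M P P']] obtain \<phi> \<psi> \<phi>' \<psi>' h where
    \<phi>: "\<phi> \<in> module_homs R ?F ?F'" and \<psi>: "\<psi> \<in> module_homs R ?F' ?F"
    and \<phi>': "\<phi>' \<in> module_homs R ?G ?G'" "\<And>x. x \<in> carrier ?G \<Longrightarrow> d' n (\<phi>' x) = \<phi> (d n x)"
    and \<psi>': "\<psi>' \<in> module_homs R ?G' ?G" "\<And>y. y \<in> carrier ?G' \<Longrightarrow> d n (\<psi>' y) = \<psi> (d' n y)"
    and h: "h \<in> module_homs R ?F' ?G'"
    and id: "\<And>y. y \<in> carrier ?G' \<Longrightarrow> y \<ominus>\<^bsub>?G'\<^esub> (\<phi>' (\<psi>' y) \<oplus>\<^bsub>?G'\<^esub> h (d' n y))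
      \<in> d' (Suc n) ` carrier (free_module R (r' (Suc (Suc n))))"
    by metis
  fix f assume "f \<in> ext_cocycles R r' d' N (Suc n)"
  then have f: "f \<in> module_homs R ?G' N"
    and f0: "\<And>y. y \<in> d' (Suc n) ` carrier (free_module R (r' (Suc (Suc n)))) \<Longrightarrow> f y = \<zero>\<^bsub>N\<^esub>"
    by (auto simp: ext_cocycles_def)
  have "compose (carrier ?G) f \<phi>' \<in> ext_cocycles R r d N (Suc n)"
  proof -
    have "f (\<phi>' (d (Suc n) x)) = \<zero>\<^bsub>N\<^esub>" if "x \<in> carrier (free_module R (r (Suc (Suc n))))" for x
    proof -
      have "d (Suc n) x \<in> carrier ?G" "d n (d (Suc n) x) = \<zero>\<^bsub>?F\<^esub>"
        using ex[of "d (Suc n) x"] that by auto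
      then have "\<phi>' (d (Suc n) x) \<in> d' (Suc n) ` carrier (free_module R (r' (Suc (Suc n))))"
        using \<phi>'(2) module_homsD(2)[OF \<phi>'(1)] module_homs_zero[OF F F' \<phi>] by (simp add: ex')
      then show ?thesis by (rule f0)
    qed
    then show ?thesis
      using module_homs_compose[OF G \<phi>'(1) f] module_homsD(2)[OF d[of "Suc n"]]
      by (simp add: ext_cocycles_def compose_def)
  qed
  with exact have "compose (carrier ?G) f \<phi>' \<in> ext_coboundaries R r d N (Suc n)" by blast
  then obtain g where g: "g \<in> module_homs R ?F N"
    and "compose (carrier ?G) f \<phi>' = compose (carrier ?G) g (d n)"
    by auto
  then have fg: "f (\<phi>' x) = g (d n x)" if "x \<in> carrier ?G" for x
    using that by (metis compose_eq)
  define u where "u = (\<lambda>y\<in>carrier ?F'. compose (carrier ?F') g \<psi> y \<oplus>\<^bsub>N\<^esub> compose (carrier ?F') f h y)"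
  have u: "u \<in> module_homs R ?F' N"
    unfolding u_def
    by (intro module_homs_add[OF F' N] module_homs_compose[OF F' \<psi> g] module_homs_compose[OF F' h f])
  have "f = compose (carrier ?G') u (d' n)"
  proof (rule module_homs_eqI[OF f module_homs_compose[OF G' d' u]])
    fix y assume y: "y \<in> carrier ?G'"
    note [simp] = module_homsD(2)[OF \<phi>] module_homsD(2)[OF \<psi>] module_homsD(2)[OF \<phi>'(1)]
      module_homsD(2)[OF \<psi>'(1)] module_homsD(2)[OF h] module_homsD(2)[OF d'] module_homsD(2)[OF d]
      module_homsD(2)[OF f] y
    have "f y \<ominus>\<^bsub>N\<^esub> f (\<phi>' (\<psi>' y) \<oplus>\<^bsub>?G'\<^esub> h (d' n y)) = \<zero>\<^bsub>N\<^esub>"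
      using f0[OF id[OF y]] by (simp add: module_homs_minus[OF G' N f])
    then have "f y = f (\<phi>' (\<psi>' y) \<oplus>\<^bsub>?G'\<^esub> h (d' n y))"
      by (simp add: N.M.minus_eq_zero_iff)
    also have "\<dots> = g (\<psi> (d' n y)) \<oplus>\<^bsub>N\<^esub> f (h (d' n y))"
      by (simp add: module_homsD(3)[OF f] fg \<psi>'(2))
    finally show "f y = compose (carrier ?G') u (d' n) y"
      by (simp add: compose_def u_def)
  qed
  with u show "f \<in> ext_coboundaries R r' d' N (Suc n)" by simp
qed

lemma group_ext_cocycles:
  assumes M: "left_module R M" and N: "left_module R N" and P: "free_resolution R M r d e"
  shows "group ((hom_group R (free_module R (r i)) N)\<lparr>carrier := ext_cocycles R r d N i\<rparr>)"
    (is "group ?G")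
proof -
  interpret M: left_module R M by fact
  interpret N: left_module R N by fact
  let ?F = "free_module R (r i)"
  note F = left_module_free_module[OF M.R.ring_axioms, of "r i"]
  note d = module_homsD(2)[OF free_resolutionD(2)[OF P]]
  have hom: "f \<in> module_homs R ?F N" if "f \<in> carrier ?G" for f
    using that by (simp add: ext_cocycles_def)
  have val: "f x \<in> carrier N" if "f \<in> carrier ?G" "x \<in> carrier ?F" for f x
    using module_homsD(2)[OF hom] that by blast
  have mult: "(f \<otimes>\<^bsub>?G\<^esub> g) x = f x \<oplus>\<^bsub>N\<^esub> g x" if "x \<in> carrier ?F" for f g x
    using that by (simp add: hom_group_def)
  have one: "\<one>\<^bsub>?G\<^esub> x = \<zero>\<^bsub>N\<^esub>" if "x \<in> carrier ?F" for x
    using that by (simp add: hom_group_def)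
  have closed: "f \<otimes>\<^bsub>?G\<^esub> g \<in> carrier ?G" if "f \<in> carrier ?G" "g \<in> carrier ?G" for f g
    using that module_homs_add[OF F N, of f g] d
    by (simp add: ext_cocycles_def hom_group_def)
  have one_closed: "\<one>\<^bsub>?G\<^esub> \<in> carrier ?G"
    using module_homs_const_zero[OF F N] d by (simp add: ext_cocycles_def hom_group_def)
  have ext: "f = g" if "f \<in> carrier ?G" "g \<in> carrier ?G" "\<And>x. x \<in> carrier ?F \<Longrightarrow> f x = g x" for f g
    using module_homs_eqI[OF hom hom] that by blast
  show ?thesis
  proof (rule groupI)
    fix f assume f: "f \<in> carrier ?G"
    let ?g = "\<lambda>x\<in>carrier ?F. \<ominus>\<^bsub>N\<^esub> f x"
    have g: "?g \<in> carrier ?G"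
      using module_homs_uminus[OF F N hom[OF f]] d f by (simp add: ext_cocycles_def)
    have "?g \<otimes>\<^bsub>?G\<^esub> f = \<one>\<^bsub>?G\<^esub>"
      by (intro ext closed g f one_closed)
        (simp only: mult one restrict_apply if_True val[OF f] N.M.l_neg)
    with g show "\<exists>g\<in>carrier ?G. g \<otimes>\<^bsub>?G\<^esub> f = \<one>\<^bsub>?G\<^esub>" by blast
  next
    fix f g k assume fgk: "f \<in> carrier ?G" "g \<in> carrier ?G" "k \<in> carrier ?G"
    show "f \<otimes>\<^bsub>?G\<^esub> g \<otimes>\<^bsub>?G\<^esub> k = f \<otimes>\<^bsub>?G\<^esub> (g \<otimes>\<^bsub>?G\<^esub> k)"
      by (intro ext closed fgk) (simp only: mult val[OF fgk(1)] val[OF fgk(2)] val[OF fgk(3)] N.M.a_assoc)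
  next
    fix f assume f: "f \<in> carrier ?G"
    show "\<one>\<^bsub>?G\<^esub> \<otimes>\<^bsub>?G\<^esub> f = f"
      by (intro ext closed f one_closed) (simp only: mult one val[OF f] N.M.l_zero)
  qed (fact closed one_closed)+
qed

lemma ext_coboundaries_subset_cocycles:
  assumes M: "left_module R M" and N: "left_module R N" and P: "free_resolution R M r d e"
  shows "ext_coboundaries R r d N (Suc n) \<subseteq> ext_cocycles R r d N (Suc n)"
proof
  interpret M: left_module R M by fact
  note F = left_module_free_module[OF M.R.ring_axioms]
  fix f assume "f \<in> ext_coboundaries R r d N (Suc n)"
  then obtain g where g: "g \<in> module_homs R (free_module R (r n)) N"
    and f: "f = compose (carrier (free_module R (r (Suc n)))) g (d n)" by auto
  have "f (d (Suc n) x) = \<zero>\<^bsub>N\<^esub>" if "x \<in> carrier (free_module R (r (Suc (Suc n))))" for x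
    using free_resolutionD(5)[OF P, of "d (Suc n) x" n] that module_homs_zero[OF F N g]
    by (auto simp: f compose_def)
  then show "f \<in> ext_cocycles R r d N (Suc n)"
    using module_homs_compose[OF F free_resolutionD(2)[OF P] g] by (simp add: f ext_cocycles_def)
qed

lemma trivial_ext_of_resolution_iff:
  assumes M: "left_module R M" and N: "left_module R N" and P: "free_resolution R M r d e"
  shows "trivial_group (ext_of_resolution R r d N (Suc n))
    \<longleftrightarrow> ext_cocycles R r d N (Suc n) \<subseteq> ext_coboundaries R r d N (Suc n)"
proof -
  interpret N: left_module R N by fact
  let ?G = "(hom_group R (free_module R (r (Suc n))) N)\<lparr>carrier := ext_cocycles R r d N (Suc n)\<rparr>"
  let ?B = "ext_coboundaries R r d N (Suc n)"
  interpret G: group ?G by (rule group_ext_cocycles[OF assms])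
  note sub = ext_coboundaries_subset_cocycles[OF assms, of n]
  show ?thesis
  proof
    assume "trivial_group (ext_of_resolution R r d N (Suc n))"
    then have cosets: "carrier (?G Mod ?B) = {?B}"
      by (simp add: trivial_group_def ext_of_resolution_def FactGroup_def)
    have one_B: "\<one>\<^bsub>?G\<^esub> \<in> ?B"
    proof -
      note d = free_resolutionD(2)[OF P, of n]
      have F: "left_module R (free_module R (r n))" "left_module R (free_module R (r (Suc n)))"
        using left_module_free_module[OF N.R.ring_axioms] by blast+
      have "\<one>\<^bsub>?G\<^esub> = compose (carrier (free_module R (r (Suc n))))
          (\<lambda>x\<in>carrier (free_module R (r n)). \<zero>\<^bsub>N\<^esub>) (d n)"
        using module_homsD(2)[OF d] by (auto simp: hom_group_def compose_def)
      then show ?thesis using module_homs_const_zero[OF F(1) N] by simp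
    qed
    show "ext_cocycles R r d N (Suc n) \<subseteq> ?B"
    proof
      fix f assume "f \<in> ext_cocycles R r d N (Suc n)"
      then have f: "f \<in> carrier ?G" by simp
      have "?B #>\<^bsub>?G\<^esub> f \<in> carrier (?G Mod ?B)"
        using f by (auto simp: FactGroup_def RCOSETS_def)
      then have "?B #>\<^bsub>?G\<^esub> f = ?B" unfolding cosets by blast
      moreover have "\<one>\<^bsub>?G\<^esub> \<otimes>\<^bsub>?G\<^esub> f \<in> ?B #>\<^bsub>?G\<^esub> f"
        using one_B unfolding r_coset_def by blast
      ultimately show "f \<in> ?B" by (simp only: G.l_one[OF f])
    qed
  next
    assume "ext_cocycles R r d N (Suc n) \<subseteq> ?B"
    with sub have eq: "?B = carrier ?G" by auto
    have "group (?G Mod carrier ?G)"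
      by (rule normal.factorgroup_is_group) (rule G.normal_self)
    moreover have "carrier (?G Mod carrier ?G) = {\<one>\<^bsub>?G Mod carrier ?G\<^esub>}"
    proof -
      have "carrier ?G #>\<^bsub>?G\<^esub> f = carrier ?G" if "f \<in> carrier ?G" for f
        using G.coset_join2[OF that G.subgroup_self that] .
      then show ?thesis
        using G.one_closed unfolding FactGroup_def RCOSETS_def by auto
    qed
    ultimately show "trivial_group (ext_of_resolution R r d N (Suc n))"
      unfolding trivial_group_def ext_of_resolution_def eq by blast
  qed
qed

text \<open>
  The chosen resolution is one of the free resolutions because \<open>P\<close> exhibits one; its exactness properties
  are those of \<open>P\<close>.
\<close>

theorem semi_gorenstein_projective_iff:
  assumes M: "left_module R M" and P: "free_resolution R M r d e"
  shows "semi_gorenstein_projective R M \<longleftrightarrow>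
    (\<forall>n. ext_cocycles R r d (regular_module R) (Suc n) \<subseteq> ext_coboundaries R r d (regular_module R) (Suc n))"
proof -
  interpret M: left_module R M by fact
  note N = left_module_regular_module[OF M.R.ring_axioms]
  obtain r' d' e' where eq: "(SOME (r, d, e). free_resolution R M r d e) = (r', d', e')"
    by (metis prod_cases3)
  have P': "free_resolution R M r' d' e'"
    using someI[of "\<lambda>(r, d, e). free_resolution R M r d e" "(r, d, e)"] P eq by simp
  have "semi_gorenstein_projective R M \<longleftrightarrow>
      (\<forall>n. trivial_group (ext_of_resolution R r' d' (regular_module R) (Suc n)))"
    by (auto simp: semi_gorenstein_projective_def Ext_def eq Suc_le_eq gr0_conv_Suc)
  also have "\<dots> \<longleftrightarrow> (\<forall>n. ext_cocycles R r' d' (regular_module R) (Suc n)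
      \<subseteq> ext_coboundaries R r' d' (regular_module R) (Suc n))"
    by (simp only: trivial_ext_of_resolution_iff[OF M N P'])
  also have "\<dots> \<longleftrightarrow> (\<forall>n. ext_cocycles R r d (regular_module R) (Suc n)
      \<subseteq> ext_coboundaries R r d (regular_module R) (Suc n))"
    using exactness_transfer[OF M N P P'] exactness_transfer[OF M N P' P] by blast
  finally show ?thesis .
qed

section \<open>Cyclic modules with a principal relation ideal\<close>

text \<open>
  This is the left annihilator; the right annihilator of \<open>w\<close> in \<open>R\<close> is \<open>annihilator (opposite R) w\<close>.
  Likewise \<open>PIdl\<close>, over a ring that need not be commutative, is the principal left ideal, and
  \<open>PIdl\<^bsub>opposite R\<^esub> w\<close> is \<open>w R\<close>.
\<close>

definition annihilator :: "('a, 'n) ring_scheme \<Rightarrow> 'a \<Rightarrow> 'a set" where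
  "annihilator R w = {a \<in> carrier R. a \<otimes>\<^bsub>R\<^esub> w = \<zero>\<^bsub>R\<^esub>}"

text \<open>
  That is, \<open>a \<mapsto> a v\<close> induces an isomorphism from \<open>R / R w\<close> to \<open>U\<close>.  A module given in another way,
  such as a dual, can thus be recognised as \<open>R / R w\<close> without a transport along an isomorphism.
\<close>

definition presented_by ::
    "('a, 'n) ring_scheme \<Rightarrow> ('a, 'b, 'm) module_scheme \<Rightarrow> 'b \<Rightarrow> 'a \<Rightarrow> bool" where
  "presented_by R U v w \<longleftrightarrow>
     v \<in> carrier U \<and> w \<in> carrier R \<and> (\<lambda>a. a \<odot>\<^bsub>U\<^esub> v) ` carrier R = carrier U \<and>
     {a \<in> carrier R. a \<odot>\<^bsub>U\<^esub> v = \<zero>\<^bsub>U\<^esub>} = PIdl\<^bsub>R\<^esub> w"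

lemma presented_byD:
  assumes "presented_by R U v w"
  shows "v \<in> carrier U" "w \<in> carrier R"
    and "x \<in> carrier U \<Longrightarrow> \<exists>a\<in>carrier R. x = a \<odot>\<^bsub>U\<^esub> v"
    and "a \<in> carrier R \<Longrightarrow> a \<odot>\<^bsub>U\<^esub> v = \<zero>\<^bsub>U\<^esub> \<longleftrightarrow> a \<in> PIdl\<^bsub>R\<^esub> w"
  using assms by (auto simp: presented_by_def)

\<comment> \<open>Otherwise the simplifier rewrites the rank in \<open>free_module R 1\<close> to \<open>Suc 0\<close>.\<close>
declare One_nat_def [simp del]

definition rank_one_map :: "('a, 'n) ring_scheme \<Rightarrow> 'a \<Rightarrow> (nat \<Rightarrow> 'a) \<Rightarrow> nat \<Rightarrow> 'a" where
  "rank_one_map R w = (\<lambda>x\<in>carrier (free_module R 1). \<lambda>i\<in>{..<1}. x 0 \<otimes>\<^bsub>R\<^esub> w)"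

lemma free_module_1_sel:
  shows "x \<in> carrier (free_module R 1) \<Longrightarrow> x 0 \<in> carrier R"
    and "(x \<oplus>\<^bsub>free_module R 1\<^esub> y) 0 = x 0 \<oplus>\<^bsub>R\<^esub> y 0"
    and "(a \<odot>\<^bsub>free_module R 1\<^esub> x) 0 = a \<otimes>\<^bsub>R\<^esub> x 0"
    and "\<zero>\<^bsub>free_module R 1\<^esub> 0 = \<zero>\<^bsub>R\<^esub>"
    and "a \<in> carrier R \<Longrightarrow> (\<lambda>i\<in>{..<1}. a) \<in> carrier (free_module R 1)"
  by (auto simp: free_module_def)

lemma free_module_1_eqI:
  assumes "x \<in> carrier (free_module R 1)" "y \<in> carrier (free_module R 1)" "x 0 = y 0"
  shows "x = y"
  using assms by (auto simp: free_module_def intro: PiE_ext)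

lemma rank_one_map_sel:
  assumes "ring R" "w \<in> carrier R" "x \<in> carrier (free_module R 1)"
  shows "rank_one_map R w x \<in> carrier (free_module R 1)" "rank_one_map R w x 0 = x 0 \<otimes>\<^bsub>R\<^esub> w"
proof -
  interpret R: ring R by fact
  show "rank_one_map R w x \<in> carrier (free_module R 1)" "rank_one_map R w x 0 = x 0 \<otimes>\<^bsub>R\<^esub> w"
    using assms free_module_1_sel(1)[of x R]
    by (auto simp: rank_one_map_def intro!: free_module_1_sel(5))
qed

lemma rank_one_map_hom:
  assumes "ring R" "w \<in> carrier R"
  shows "rank_one_map R w \<in> module_homs R (free_module R 1) (free_module R 1)"
proof -
  interpret R: ring R by fact
  interpret F: left_module R "free_module R 1" by (rule left_module_free_module) fact
  note sel = rank_one_map_sel[OF assms]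
  show ?thesis
  proof (rule module_homsI)
    show "rank_one_map R w \<in> carrier (free_module R 1) \<rightarrow>\<^sub>E carrier (free_module R 1)"
      using sel(1) by (auto simp: rank_one_map_def)
  qed (auto intro!: free_module_1_eqI[where R=R] sel(1) F.M.a_closed F.smult_closed
      simp: sel(2) free_module_1_sel(1-4) R.l_distr R.m_assoc assms)
qed

lemma rank_one_map_image:
  assumes "ring R" "w \<in> carrier R"
  shows "rank_one_map R w ` carrier (free_module R 1)
    = {x \<in> carrier (free_module R 1). x 0 \<in> PIdl\<^bsub>R\<^esub> w}"
proof -
  interpret R: ring R by fact
  note sel = rank_one_map_sel[OF assms]
  show ?thesis
  proof (intro equalityI subsetI)
    fix x assume "x \<in> {x \<in> carrier (free_module R 1). x 0 \<in> PIdl\<^bsub>R\<^esub> w}"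
    then obtain a where x: "x \<in> carrier (free_module R 1)" and a: "a \<in> carrier R" "x 0 = a \<otimes>\<^bsub>R\<^esub> w"
      by (auto simp: cgenideal_def)
    note s = free_module_1_sel(5)[OF a(1)]
    have "x = rank_one_map R w (\<lambda>i\<in>{..<1}. a)"
      using a(2) by (intro free_module_1_eqI[OF x sel(1)[OF s]]) (simp add: sel(2)[OF s])
    with s show "x \<in> rank_one_map R w ` carrier (free_module R 1)" by blast
  next
    fix x assume "x \<in> rank_one_map R w ` carrier (free_module R 1)"
    then show "x \<in> {x \<in> carrier (free_module R 1). x 0 \<in> PIdl\<^bsub>R\<^esub> w}"
      using sel free_module_1_sel(1)[of _ R] by (auto simp: cgenideal_def)
  qed
qed

lemma free_resolution_of_cyclic:
  assumes U: "left_module R U" and pres: "presented_by R U v (w 0)"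
    and w: "\<And>i. w i \<in> carrier R" and ann: "\<And>i. annihilator R (w i) = PIdl\<^bsub>R\<^esub> (w (Suc i))"
  shows "free_resolution R U (\<lambda>_. 1) (\<lambda>i. rank_one_map R (w i))
    (\<lambda>x\<in>carrier (free_module R 1). x 0 \<odot>\<^bsub>U\<^esub> v)"
proof -
  interpret U: left_module R U by fact
  note ring = U.R.ring_axioms
  interpret F: left_module R "free_module R 1" by (rule left_module_free_module[OF ring])
  note p = presented_byD[OF pres]
  note sel = free_module_1_sel[where R=R]
  let ?e = "\<lambda>x\<in>carrier (free_module R 1). x 0 \<odot>\<^bsub>U\<^esub> v"
  have e: "?e \<in> module_homs R (free_module R 1) U"
    by (rule module_homsI)
      (auto simp: sel(1-4) p(1) U.smult_l_distr U.smult_assoc1)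
  have surj: "?e ` carrier (free_module R 1) = carrier U"
  proof
    show "carrier U \<subseteq> ?e ` carrier (free_module R 1)"
    proof
      fix x assume "x \<in> carrier U"
      then obtain a where a: "a \<in> carrier R" "x = a \<odot>\<^bsub>U\<^esub> v" using p(3) by blast
      with sel(5)[OF a(1)] show "x \<in> ?e ` carrier (free_module R 1)"
        by (intro image_eqI[where x = "\<lambda>i\<in>{..<1}. a"]) auto
    qed
  qed (use module_homsD(2)[OF e] in blast)
  have k0: "rank_one_map R (w 0) ` carrier (free_module R 1) = a_kernel (free_module R 1) U ?e"
    using p(4) sel(1) by (auto simp: rank_one_map_image[OF ring w] a_kernel_def')
  have k: "rank_one_map R (w (Suc i)) ` carrier (free_module R 1)
      = a_kernel (free_module R 1) (free_module R 1) (rank_one_map R (w i))" for i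
  proof -
    have "rank_one_map R (w i) x = \<zero>\<^bsub>free_module R 1\<^esub> \<longleftrightarrow> x 0 \<otimes>\<^bsub>R\<^esub> w i = \<zero>\<^bsub>R\<^esub>"
      if "x \<in> carrier (free_module R 1)" for x
      using rank_one_map_sel[OF ring w that, of i] sel(4)
        free_module_1_eqI[of "rank_one_map R (w i) x" R "\<zero>\<^bsub>free_module R 1\<^esub>"] F.M.zero_closed
      by (metis (no_types))
    then show ?thesis
      using sel(1) ann[of i, symmetric]
      by (auto simp: rank_one_map_image[OF ring w] a_kernel_def' annihilator_def)
  qed
  show ?thesis
    unfolding free_resolution_def Let_def
    using e rank_one_map_hom[OF ring w] surj k0 k by blast
qed

text \<open>
  A homomorphism \<open>R \<rightarrow> R\<close> is the right multiplication by an element \<open>u\<close>.  In degree \<open>n + 1\<close> it is a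
  cocycle if and only if \<open>w (n + 1) u = 0\<close>, and a coboundary if and only if \<open>u\<close> is a right
  multiple of \<open>w n\<close>.
\<close>

theorem cyclic_semi_gorenstein_projective_iff:
  assumes U: "left_module R U" and pres: "presented_by R U v (w 0)"
    and w: "\<And>i. w i \<in> carrier R" and ann: "\<And>i. annihilator R (w i) = PIdl\<^bsub>R\<^esub> (w (Suc i))"
  shows "semi_gorenstein_projective R U \<longleftrightarrow>
    (\<forall>n. annihilator (opposite R) (w (Suc n)) \<subseteq> PIdl\<^bsub>opposite R\<^esub> (w n))"
proof -
  interpret U: left_module R U by fact
  note ring = U.R.ring_axioms
  let ?F = "free_module R 1" and ?N = "regular_module R"
  interpret F: left_module R ?F by (rule left_module_free_module[OF ring])
  note sel = free_module_1_sel[where R=R]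
  define \<delta> where "\<delta> = (\<lambda>i\<in>{..<1::nat}. \<one>\<^bsub>R\<^esub>)"
  have \<delta>: "\<delta> \<in> carrier ?F" "\<delta> 0 = \<one>\<^bsub>R\<^esub>" unfolding \<delta>_def using sel(5)[of "\<one>\<^bsub>R\<^esub>"] by auto
  define right where "right u = (\<lambda>x\<in>carrier ?F. x 0 \<otimes>\<^bsub>R\<^esub> u)" for u
  have right: "right u \<in> module_homs R ?F ?N" if "u \<in> carrier R" for u
    unfolding right_def using that
    by (intro module_homsI)
      (auto simp: sel(1-4) regular_module_def U.R.l_distr U.R.m_assoc)
  have hom: "f \<delta> \<in> carrier R" "f = right (f \<delta>)" if f: "f \<in> module_homs R ?F ?N" for f
  proof -
    show *: "f \<delta> \<in> carrier R" using module_homsD(2)[OF f \<delta>(1)] by (simp add: regular_module_def)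
    show "f = right (f \<delta>)"
    proof (rule module_homs_eqI[OF f right[OF *]])
      fix x assume x: "x \<in> carrier ?F"
      have "x = x 0 \<odot>\<^bsub>?F\<^esub> \<delta>"
        using x sel(1) \<delta> by (intro free_module_1_eqI[where R=R]) (auto simp: sel(3))
      then have "f x = f (x 0 \<odot>\<^bsub>?F\<^esub> \<delta>)" by simp
      also have "\<dots> = x 0 \<otimes>\<^bsub>R\<^esub> f \<delta>"
        using module_homsD(4)[OF f sel(1)[OF x] \<delta>(1)] by (simp add: regular_module_def)
      finally show "f x = right (f \<delta>) x" using x by (simp add: right_def)
    qed
  qed
  have coc: "right u \<in> ext_cocycles R (\<lambda>_. 1) (\<lambda>i. rank_one_map R (w i)) ?N (Suc n)
      \<longleftrightarrow> u \<in> annihilator (opposite R) (w (Suc n))" if u: "u \<in> carrier R" for u n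
  proof -
    have val: "right u (rank_one_map R (w (Suc n)) x) = x 0 \<otimes>\<^bsub>R\<^esub> (w (Suc n) \<otimes>\<^bsub>R\<^esub> u)" if "x \<in> carrier ?F" for x
      using rank_one_map_sel[OF ring w that] u w sel(1)[OF that] that
      by (simp add: right_def U.R.m_assoc)
    have "(\<forall>x\<in>carrier ?F. x 0 \<otimes>\<^bsub>R\<^esub> (w (Suc n) \<otimes>\<^bsub>R\<^esub> u) = \<zero>\<^bsub>R\<^esub>) \<longleftrightarrow> w (Suc n) \<otimes>\<^bsub>R\<^esub> u = \<zero>\<^bsub>R\<^esub>"
      using \<delta> sel(1) u w by (metis U.R.l_one U.R.m_closed U.R.r_null)
    then show ?thesis
      using right[OF u] u val by (simp add: ext_cocycles_def annihilator_def regular_module_def)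
  qed
  have cob: "right u \<in> ext_coboundaries R (\<lambda>_. 1) (\<lambda>i. rank_one_map R (w i)) ?N (Suc n)
      \<longleftrightarrow> u \<in> PIdl\<^bsub>opposite R\<^esub> (w n)" if u: "u \<in> carrier R" for u n
  proof -
    have comp: "compose (carrier ?F) (right t) (rank_one_map R (w n)) = right (w n \<otimes>\<^bsub>R\<^esub> t)"
      if t: "t \<in> carrier R" for t
    proof (rule module_homs_eqI[where R=R and M="?F" and N="?N"])
      show "right (w n \<otimes>\<^bsub>R\<^esub> t) \<in> module_homs R ?F ?N" using right t w by simp
      show "compose (carrier ?F) (right t) (rank_one_map R (w n)) \<in> module_homs R ?F ?N"
        by (rule module_homs_compose[OF F.left_module_axioms rank_one_map_hom[OF ring w] right[OF t]])
      fix x assume x: "x \<in> carrier ?F"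
      show "compose (carrier ?F) (right t) (rank_one_map R (w n)) x = right (w n \<otimes>\<^bsub>R\<^esub> t) x"
        using rank_one_map_sel[OF ring w x] t w sel(1)[OF x] x
        by (simp add: right_def compose_def U.R.m_assoc)
    qed
    have inj: "right u = right t \<longleftrightarrow> u = t" if "t \<in> carrier R" for t
    proof
      assume "right u = right t"
      then have "right u \<delta> = right t \<delta>" by simp
      then show "u = t" using \<delta> u that by (simp add: right_def)
    qed simp
    have homs: "module_homs R ?F ?N = right ` carrier R" using hom right by blast
    have "right u \<in> ext_coboundaries R (\<lambda>_. 1) (\<lambda>i. rank_one_map R (w i)) ?N (Suc n)
        \<longleftrightarrow> (\<exists>t\<in>carrier R. right u = right (w n \<otimes>\<^bsub>R\<^esub> t))"
      unfolding ext_coboundaries.simps homs using comp by (auto simp: image_iff)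
    also have "\<dots> \<longleftrightarrow> (\<exists>t\<in>carrier R. u = w n \<otimes>\<^bsub>R\<^esub> t)" using inj w by auto
    finally show ?thesis by (auto simp: cgenideal_def)
  qed
  have "ext_cocycles R (\<lambda>_. 1) (\<lambda>i. rank_one_map R (w i)) ?N (Suc n)
        \<subseteq> ext_coboundaries R (\<lambda>_. 1) (\<lambda>i. rank_one_map R (w i)) ?N (Suc n)
      \<longleftrightarrow> annihilator (opposite R) (w (Suc n)) \<subseteq> PIdl\<^bsub>opposite R\<^esub> (w n)" (is "?C \<subseteq> ?B \<longleftrightarrow> ?a \<subseteq> ?p") for n
  proof
    assume l: "?C \<subseteq> ?B"
    show "?a \<subseteq> ?p"
    proof
      fix u assume "u \<in> ?a"
      moreover from this have "u \<in> carrier R" by (simp add: annihilator_def)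
      ultimately show "u \<in> ?p" using l coc cob by blast
    qed
  next
    assume r: "?a \<subseteq> ?p"
    show "?C \<subseteq> ?B"
    proof
      fix f assume f: "f \<in> ?C"
      then have "f \<in> module_homs R ?F ?N" by (simp add: ext_cocycles_def)
      from hom[OF this] f r coc cob show "f \<in> ?B" by (metis subsetD)
    qed
  qed
  then show ?thesis
    unfolding semi_gorenstein_projective_iff[OF U free_resolution_of_cyclic[of R U v w, OF U pres w ann]]
    by simp
qed

section \<open>Duals of cyclic modules\<close>

lemma dual_value:
  assumes "left_module R U" "v \<in> carrier U" "f \<in> carrier (dual R U)" "a \<in> carrier R"
  shows "f v \<in> carrier R" "f (a \<odot>\<^bsub>U\<^esub> v) = a \<otimes>\<^bsub>R\<^esub> f v"
  using assms module_homsD(2,4)[of f R U "regular_module R"]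
  by (auto simp: dual_def regular_module_def)

text \<open>
  This lemma and the next two say that evaluation at \<open>v\<close> identifies the dual of \<open>R / R w\<close> with the right
  annihilator of \<open>w\<close>.
\<close>

lemma dual_value_annihilated:
  assumes U: "left_module R U" and pres: "presented_by R U v w" and f: "f \<in> carrier (dual R U)"
  shows "f v \<in> annihilator (opposite R) w"
proof -
  interpret U: left_module R U by fact
  note p = presented_byD[OF pres]
  have f': "f \<in> module_homs R U (regular_module R)" using f by (simp add: dual_def)
  have "w = \<one>\<^bsub>R\<^esub> \<otimes>\<^bsub>R\<^esub> w" using p(2) by simp
  then have "w \<in> PIdl\<^bsub>R\<^esub> w" unfolding cgenideal_def by blast
  then have "w \<odot>\<^bsub>U\<^esub> v = \<zero>\<^bsub>U\<^esub>" using p(2,4) by blast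
  moreover have "f \<zero>\<^bsub>U\<^esub> = \<zero>\<^bsub>R\<^esub>"
    using module_homs_zero[OF U left_module_regular_module[OF U.R.ring_axioms] f']
    by (simp add: regular_module_def)
  ultimately show ?thesis
    using dual_value[OF U p(1) f p(2)] by (simp add: annihilator_def)
qed

lemma dual_hom_of_annihilated:
  assumes U: "left_module R U" and pres: "presented_by R U v w"
    and u: "u \<in> annihilator (opposite R) w"
  obtains g where "g \<in> carrier (dual R U)" "g v = u"
proof -
  interpret U: left_module R U by fact
  note p = presented_byD[OF pres]
  have uR: "u \<in> carrier R" and wu: "w \<otimes>\<^bsub>R\<^esub> u = \<zero>\<^bsub>R\<^esub>" using u by (simp_all add: annihilator_def)
  define g where "g = (\<lambda>m\<in>carrier U. (SOME a. a \<in> carrier R \<and> m = a \<odot>\<^bsub>U\<^esub> v) \<otimes>\<^bsub>R\<^esub> u)"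
  \<comment> \<open>Two coefficients of the same element differ by an element of \<open>R w\<close>, and \<open>w u = 0\<close>; so the choice in
    the definition of \<open>g\<close> does not matter.\<close>
  have g_eq: "g (b \<odot>\<^bsub>U\<^esub> v) = b \<otimes>\<^bsub>R\<^esub> u" if b: "b \<in> carrier R" for b
  proof -
    define a where "a = (SOME a. a \<in> carrier R \<and> b \<odot>\<^bsub>U\<^esub> v = a \<odot>\<^bsub>U\<^esub> v)"
    have "\<exists>a. a \<in> carrier R \<and> b \<odot>\<^bsub>U\<^esub> v = a \<odot>\<^bsub>U\<^esub> v" using b by blast
    from someI_ex[OF this] have a: "a \<in> carrier R" "b \<odot>\<^bsub>U\<^esub> v = a \<odot>\<^bsub>U\<^esub> v"
      by (simp_all add: a_def)
    have "(a \<ominus>\<^bsub>R\<^esub> b) \<odot>\<^bsub>U\<^esub> v = \<zero>\<^bsub>U\<^esub>"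
      using a b p(1) by (simp add: a_minus_def U.smult_l_distr U.smult_l_minus U.M.r_neg)
    then have "a \<ominus>\<^bsub>R\<^esub> b \<in> PIdl\<^bsub>R\<^esub> w" using p(4) a b by simp
    then obtain c where c: "c \<in> carrier R" "a \<ominus>\<^bsub>R\<^esub> b = c \<otimes>\<^bsub>R\<^esub> w" by (auto simp: cgenideal_def)
    then have "(a \<ominus>\<^bsub>R\<^esub> b) \<otimes>\<^bsub>R\<^esub> u = \<zero>\<^bsub>R\<^esub>" using wu uR p(2) by (simp add: U.R.m_assoc)
    then have "a \<otimes>\<^bsub>R\<^esub> u \<ominus>\<^bsub>R\<^esub> b \<otimes>\<^bsub>R\<^esub> u = \<zero>\<^bsub>R\<^esub>"
      using a b uR by (simp add: a_minus_def U.R.l_distr U.R.l_minus)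
    then have "a \<otimes>\<^bsub>R\<^esub> u = b \<otimes>\<^bsub>R\<^esub> u" using a b uR by (simp add: U.R.minus_eq_zero_iff)
    moreover have "g (b \<odot>\<^bsub>U\<^esub> v) = a \<otimes>\<^bsub>R\<^esub> u" using b p(1) by (simp add: g_def a_def)
    ultimately show ?thesis by simp
  qed
  have "g \<in> module_homs R U (regular_module R)"
  proof (rule module_homsI)
    show "g \<in> carrier U \<rightarrow>\<^sub>E carrier (regular_module R)"
    proof
      fix m assume "m \<in> carrier U"
      then obtain a where "a \<in> carrier R" "m = a \<odot>\<^bsub>U\<^esub> v" using p(3) by blast
      then show "g m \<in> carrier (regular_module R)"
        using g_eq uR by (simp add: regular_module_def)
    qed (simp add: g_def)
  next
    fix m n assume "m \<in> carrier U" "n \<in> carrier U"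
    then obtain a b where "a \<in> carrier R" "m = a \<odot>\<^bsub>U\<^esub> v" "b \<in> carrier R" "n = b \<odot>\<^bsub>U\<^esub> v"
      using p(3) by blast
    then show "g (m \<oplus>\<^bsub>U\<^esub> n) = g m \<oplus>\<^bsub>regular_module R\<^esub> g n"
      using g_eq[of a] g_eq[of b] g_eq[of "a \<oplus>\<^bsub>R\<^esub> b"] uR p(1)
      by (simp add: regular_module_def U.smult_l_distr U.R.l_distr)
  next
    fix c m assume c: "c \<in> carrier R" and "m \<in> carrier U"
    then obtain a where "a \<in> carrier R" "m = a \<odot>\<^bsub>U\<^esub> v" using p(3) by blast
    then show "g (c \<odot>\<^bsub>U\<^esub> m) = c \<odot>\<^bsub>regular_module R\<^esub> g m"
      using g_eq[of a] g_eq[of "c \<otimes>\<^bsub>R\<^esub> a"] uR p(1) c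
      by (simp add: regular_module_def U.smult_assoc1[symmetric] U.R.m_assoc)
  qed
  moreover have "g v = u" using g_eq[of "\<one>\<^bsub>R\<^esub>"] p(1) uR by simp
  ultimately show ?thesis using that by (simp add: dual_def)
qed

lemma dual_eqI:
  assumes U: "left_module R U" and pres: "presented_by R U v w"
    and f: "f \<in> carrier (dual R U)" and g: "g \<in> carrier (dual R U)" and eq: "f v = g v"
  shows "f = g"
proof -
  note p = presented_byD[OF pres]
  have "f m = g m" if "m \<in> carrier U" for m
    using p(3)[OF that] dual_value[OF U p(1) f] dual_value[OF U p(1) g] eq by auto
  then show ?thesis
    using f g module_homs_eqI[of f R U "regular_module R" g] by (simp add: dual_def)
qed

lemma dual_smult_value:
  assumes "m \<in> carrier U"
  shows "(a \<odot>\<^bsub>dual R U\<^esub> f) m = f m \<otimes>\<^bsub>R\<^esub> a"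
  using assms by (simp add: dual_def)

text \<open>
  The dual is the right annihilator of \<open>w\<close>, that is, the right ideal \<open>u R\<close>, and \<open>a \<mapsto> u a\<close> has kernel
  \<open>w' R\<close>.  The equation \<open>g v = u\<close> keeps track of the pairing of the two generators, which determines the
  canonical map to the bidual.
\<close>

theorem dual_presented_by:
  assumes U: "left_module R U" and pres: "presented_by R U v w"
    and u: "u \<in> carrier R" "annihilator (opposite R) w = PIdl\<^bsub>opposite R\<^esub> u"
    and w': "w' \<in> carrier R" "annihilator (opposite R) u = PIdl\<^bsub>opposite R\<^esub> w'"
  obtains g where "presented_by (opposite R) (dual R U) g w'" "g v = u"
proof -
  interpret U: left_module R U by fact
  interpret D: left_module "opposite R" "dual R U" by (rule left_module_dual[OF U])
  note p = presented_byD[OF pres]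
  have "u = \<one>\<^bsub>opposite R\<^esub> \<otimes>\<^bsub>opposite R\<^esub> u" "\<one>\<^bsub>opposite R\<^esub> \<in> carrier (opposite R)" using u by simp_all
  then have "u \<in> PIdl\<^bsub>opposite R\<^esub> u" unfolding cgenideal_def by blast
  then have "u \<in> annihilator (opposite R) w" using u by simp
  from dual_hom_of_annihilated[OF U pres this]
  obtain g where g: "g \<in> carrier (dual R U)" "g v = u" by blast
  note sv = dual_smult_value[OF p(1), of R]
  have smult: "a \<odot>\<^bsub>dual R U\<^esub> g \<in> carrier (dual R U)" if "a \<in> carrier R" for a
    using D.smult_closed[of a g] g that by simp
  have "carrier (dual R U) \<subseteq> (\<lambda>a. a \<odot>\<^bsub>dual R U\<^esub> g) ` carrier (opposite R)"
  proof
    fix f assume f: "f \<in> carrier (dual R U)"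
    then have "f v \<in> PIdl\<^bsub>opposite R\<^esub> u"
      using dual_value_annihilated[OF U pres f] u by simp
    then obtain a where a: "a \<in> carrier R" "f v = u \<otimes>\<^bsub>R\<^esub> a" by (auto simp: cgenideal_def)
    then have "f = a \<odot>\<^bsub>dual R U\<^esub> g"
      using g by (intro dual_eqI[OF U pres f smult]) (simp_all add: sv)
    with a show "f \<in> (\<lambda>a. a \<odot>\<^bsub>dual R U\<^esub> g) ` carrier (opposite R)" by auto
  qed
  moreover have "{a \<in> carrier (opposite R). a \<odot>\<^bsub>dual R U\<^esub> g = \<zero>\<^bsub>dual R U\<^esub>} = PIdl\<^bsub>opposite R\<^esub> w'"
  proof -
    have "a \<odot>\<^bsub>dual R U\<^esub> g = \<zero>\<^bsub>dual R U\<^esub> \<longleftrightarrow> u \<otimes>\<^bsub>R\<^esub> a = \<zero>\<^bsub>R\<^esub>" if a: "a \<in> carrier R" for a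
    proof -
      have z: "\<zero>\<^bsub>dual R U\<^esub> v = \<zero>\<^bsub>R\<^esub>" using p(1) by (simp add: dual_def)
      show ?thesis
        using dual_eqI[OF U pres smult[OF a] D.M.zero_closed] sv[of a g] z g(2) by auto
    qed
    then show ?thesis unfolding w'(2)[symmetric] by (auto simp: annihilator_def)
  qed
  ultimately have "presented_by (opposite R) (dual R U) g w'"
    using g w' smult by (auto simp: presented_by_def)
  then show ?thesis using g(2) that by blast
qed

lemma canonical_map_value:
  assumes "f \<in> carrier (dual R U)"
  shows "canonical_map R U m f = f m"
  using assms by (simp add: canonical_map_def)

lemma canonical_map_closed:
  assumes U: "left_module R U" and m: "m \<in> carrier U"
  shows "canonical_map R U m \<in> carrier (bidual R U)"
proof -
  interpret U: left_module R U by fact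
  interpret D: left_module "opposite R" "dual R U" by (rule left_module_dual[OF U])
  have "canonical_map R U m
      \<in> module_homs (opposite R) (dual R U) (regular_module (opposite R))"
  proof (rule module_homsI)
    show "canonical_map R U m \<in> carrier (dual R U) \<rightarrow>\<^sub>E carrier (regular_module (opposite R))"
      using dual_value(1)[OF U m _ U.R.zero_closed]
      by (auto simp: canonical_map_def regular_module_def)
  next
    fix f g assume fg: "f \<in> carrier (dual R U)" "g \<in> carrier (dual R U)"
    have "(f \<oplus>\<^bsub>dual R U\<^esub> g) m = f m \<oplus>\<^bsub>R\<^esub> g m" using m by (simp add: dual_def)
    with fg show "canonical_map R U m (f \<oplus>\<^bsub>dual R U\<^esub> g)
        = canonical_map R U m f \<oplus>\<^bsub>regular_module (opposite R)\<^esub> canonical_map R U m g"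
      using D.M.a_closed[of f g]
      by (simp add: canonical_map_value regular_module_def opposite_def)
  next
    fix a f assume af: "a \<in> carrier (opposite R)" "f \<in> carrier (dual R U)"
    then show "canonical_map R U m (a \<odot>\<^bsub>dual R U\<^esub> f)
        = a \<odot>\<^bsub>regular_module (opposite R)\<^esub> canonical_map R U m f"
      using D.smult_closed[of a f] dual_smult_value[OF m, of R a f]
      by (simp add: canonical_map_value regular_module_def)
  qed
  then show ?thesis by (simp add: dual_def[of "opposite R"])
qed

text \<open>
  Dualising twice gives \<open>R / R w\<close> again, with a generator \<open>G\<close> such that \<open>G g = u = g v\<close>.  So the
  canonical map sends \<open>v\<close> to \<open>G\<close>, and both generators have the annihilator \<open>R w\<close>.
\<close>

theorem cyclic_reflexive:
  assumes U: "left_module R U" and pres: "presented_by R U v w"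
    and u: "u \<in> carrier R" "annihilator (opposite R) w = PIdl\<^bsub>opposite R\<^esub> u"
    and w': "w' \<in> carrier R" "annihilator (opposite R) u = PIdl\<^bsub>opposite R\<^esub> w'"
    and left: "annihilator R w' = PIdl\<^bsub>R\<^esub> u" "annihilator R u = PIdl\<^bsub>R\<^esub> w"
  shows "reflexive R U"
proof -
  interpret U: left_module R U by fact
  note p = presented_byD[OF pres]
  note D = left_module_dual[OF U]
  from dual_presented_by[OF U pres u w'] obtain g
    where g: "presented_by (opposite R) (dual R U) g w'" "g v = u" .
  have "u \<in> carrier (opposite R)" "annihilator (opposite (opposite R)) w' = PIdl\<^bsub>opposite (opposite R)\<^esub> u"
    "w \<in> carrier (opposite R)" "annihilator (opposite (opposite R)) u = PIdl\<^bsub>opposite (opposite R)\<^esub> w"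
    using u p(2) left by simp_all
  from dual_presented_by[OF D g(1) this] obtain G
    where G: "presented_by (opposite (opposite R)) (bidual R U) G w" "G g = u" .
  note G' = G(1)[unfolded opposite_opposite]
  note pG = presented_byD[OF G']
  have gD: "g \<in> carrier (dual R U)" using presented_byD(1)[OF g(1)] .
  interpret B: left_module R "bidual R U" using left_module_dual[OF D] by simp
  have can: "canonical_map R U (a \<odot>\<^bsub>U\<^esub> v) = a \<odot>\<^bsub>bidual R U\<^esub> G" if a: "a \<in> carrier R" for a
  proof (rule dual_eqI[OF D g(1)])
    show "canonical_map R U (a \<odot>\<^bsub>U\<^esub> v) \<in> carrier (bidual R U)"
      using a p(1) by (intro canonical_map_closed[OF U]) simp
    show "a \<odot>\<^bsub>bidual R U\<^esub> G \<in> carrier (bidual R U)" using a pG(1) by simp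
    show "canonical_map R U (a \<odot>\<^bsub>U\<^esub> v) g = (a \<odot>\<^bsub>bidual R U\<^esub> G) g"
      using a gD G(2) g(2) dual_value(2)[OF U p(1) gD a]
      by (simp add: canonical_map_value dual_smult_value)
  qed
  have inj: "inj_on (canonical_map R U) (carrier U)"
  proof (rule inj_onI)
    fix m n assume mn: "m \<in> carrier U" "n \<in> carrier U" "canonical_map R U m = canonical_map R U n"
    then obtain a b where ab: "a \<in> carrier R" "m = a \<odot>\<^bsub>U\<^esub> v" "b \<in> carrier R" "n = b \<odot>\<^bsub>U\<^esub> v"
      using p(3) by metis
    have "(a \<ominus>\<^bsub>R\<^esub> b) \<odot>\<^bsub>bidual R U\<^esub> G = \<zero>\<^bsub>bidual R U\<^esub>"
      using mn(3) ab can pG(1)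
      by (simp add: a_minus_def B.smult_l_distr B.smult_l_minus B.M.r_neg)
    then have "a \<ominus>\<^bsub>R\<^esub> b \<in> PIdl\<^bsub>R\<^esub> w" using pG(4) ab by simp
    then have "(a \<ominus>\<^bsub>R\<^esub> b) \<odot>\<^bsub>U\<^esub> v = \<zero>\<^bsub>U\<^esub>" using p(4) ab by simp
    then have "m \<ominus>\<^bsub>U\<^esub> n = \<zero>\<^bsub>U\<^esub>"
      using ab p(1) by (simp add: a_minus_def U.smult_l_distr U.smult_l_minus)
    then show "m = n" using mn by (simp add: U.M.minus_eq_zero_iff)
  qed
  have "canonical_map R U ` carrier U = carrier (bidual R U)"
  proof
    show "canonical_map R U ` carrier U \<subseteq> carrier (bidual R U)"
      using canonical_map_closed[OF U] by blast
    show "carrier (bidual R U) \<subseteq> canonical_map R U ` carrier U"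
    proof
      fix H assume "H \<in> carrier (bidual R U)"
      then obtain a where "a \<in> carrier R" "H = a \<odot>\<^bsub>bidual R U\<^esub> G" using pG(3) by metis
      then show "H \<in> canonical_map R U ` carrier U"
        using can p(1) by (intro image_eqI[where x="a \<odot>\<^bsub>U\<^esub> v"]) simp_all
    qed
  qed
  with inj show ?thesis unfolding reflexive_def bij_betw_def by (rule conjI)
qed

text \<open>
  The element \<open>a v\<close> is not zero, but every homomorphism to \<open>R\<close> sends \<open>v\<close> into \<open>u R\<close> and
  hence \<open>a v\<close> to zero.
\<close>

theorem cyclic_not_reflexive:
  assumes U: "left_module R U" and pres: "presented_by R U v w"
    and u: "u \<in> carrier R" "annihilator (opposite R) w \<subseteq> PIdl\<^bsub>opposite R\<^esub> u"
    and a: "a \<in> annihilator R u" "a \<notin> PIdl\<^bsub>R\<^esub> w"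
  shows "\<not> reflexive R U"
proof
  interpret U: left_module R U by fact
  note p = presented_byD[OF pres]
  have aR: "a \<in> carrier R" and au: "a \<otimes>\<^bsub>R\<^esub> u = \<zero>\<^bsub>R\<^esub>" using a by (simp_all add: annihilator_def)
  have "canonical_map R U (a \<odot>\<^bsub>U\<^esub> v) = canonical_map R U (\<zero>\<^bsub>R\<^esub> \<odot>\<^bsub>U\<^esub> v)"
    unfolding canonical_map_def
  proof (rule restrict_ext)
    fix f assume f: "f \<in> carrier (dual R U)"
    have "f v \<in> PIdl\<^bsub>opposite R\<^esub> u" using dual_value_annihilated[OF U pres f] u by blast
    then obtain b where b: "b \<in> carrier R" "f v = u \<otimes>\<^bsub>R\<^esub> b" by (auto simp: cgenideal_def)
    have "a \<otimes>\<^bsub>R\<^esub> f v = \<zero>\<^bsub>R\<^esub>" using b u aR au by (simp add: U.R.m_assoc[symmetric])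
    then show "f (a \<odot>\<^bsub>U\<^esub> v) = f (\<zero>\<^bsub>R\<^esub> \<odot>\<^bsub>U\<^esub> v)"
      using dual_value[OF U p(1) f aR] dual_value(2)[OF U p(1) f U.R.zero_closed] by simp
  qed
  moreover assume "reflexive R U"
  ultimately have "a \<odot>\<^bsub>U\<^esub> v = \<zero>\<^bsub>R\<^esub> \<odot>\<^bsub>U\<^esub> v"
    using aR p(1) unfolding reflexive_def bij_betw_def inj_on_def by blast
  then show False using a(2) aR p(1,4) by simp
qed

section \<open>Artin algebras\<close>

lemma finsum_opposite: "finsum (opposite R) f S = finsum R f S"
  by (simp add: finsum_def opposite_def)

lemma artin_algebra_opposite:
  assumes "artin_algebra K A"
  shows "artin_algebra K (opposite A)"
proof -
  interpret A: artin_algebra K A by fact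
  have ring: "ring (opposite A)" by (rule ring_opposite) (rule A.A.ring_axioms)
  have sel: "k \<odot>\<^bsub>opposite A\<^esub> x = k \<odot>\<^bsub>A\<^esub> x" for k x by (simp add: opposite_def)
  have "finitely_generated K (opposite A)"
    using A.finitely_generated by (simp add: finitely_generated_def sel finsum_opposite)
  moreover have "module K (opposite A)"
    using ring A.K.is_cring A.smult_l_distr A.smult_r_distr A.smult_assoc1
    by (auto simp: module_def module_axioms_def ring_def sel)
  ultimately show ?thesis
    using ring A.K.artinian_cring_axioms A.smult_mult_left A.smult_mult_right
    by (simp add: artin_algebra_def artin_algebra_axioms_def sel)
qed

definition rat_field :: "rat ring" where
  "rat_field = \<lparr>carrier = UNIV, monoid.mult = (*), one = 1, ring.zero = 0, add = (+)\<rparr>"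

lemma artinian_cring_of_field:
  assumes "field F"
  shows "artinian_cring F"
proof -
  interpret F: field F by fact
  show ?thesis
  proof
    fix I :: "nat \<Rightarrow> 'a set"
    assume I: "\<And>n. ideal (I n) F" and dec: "\<And>n. I (Suc n) \<subseteq> I n"
    have cases: "I n = {\<zero>\<^bsub>F\<^esub>} \<or> I n = carrier F" for n
      using F.all_ideals I by blast
    have anti: "I n \<subseteq> I m" if "m \<le> n" for m n
      using lift_Suc_antimono_le[of I, OF dec that] .
    show "\<exists>m. \<forall>n\<ge>m. I n = I m"
    proof (cases "\<exists>m. I m = {\<zero>\<^bsub>F\<^esub>}")
      case True
      then obtain m where m: "I m = {\<zero>\<^bsub>F\<^esub>}" by blast
      have "I n = I m" if "n \<ge> m" for n
      proof -
        have "\<zero>\<^bsub>F\<^esub> \<in> I n" using cases[of n] by auto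
        with anti[OF that] show ?thesis unfolding m by auto
      qed
      then show ?thesis by blast
    next
      case False
      then show ?thesis using cases by metis
    qed
  qed
qed

lemma field_rat_field: "field rat_field"
proof -
  have "cring rat_field"
  proof (rule cringI)
    show "abelian_group rat_field"
    proof (rule abelian_groupI)
      fix x :: rat
      show "\<exists>y\<in>carrier rat_field. y \<oplus>\<^bsub>rat_field\<^esub> x = \<zero>\<^bsub>rat_field\<^esub>"
        by (rule bexI[of _ "- x"]) (simp_all add: rat_field_def)
    qed (simp_all add: rat_field_def)
    show "comm_monoid rat_field"
      by (rule comm_monoidI) (simp_all add: rat_field_def)
  qed (simp add: rat_field_def algebra_simps)
  then show ?thesis
  proof (rule cring.cring_fieldI2)
    fix a assume "a \<in> carrier rat_field" "a \<noteq> \<zero>\<^bsub>rat_field\<^esub>"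
    then show "\<exists>b\<in>carrier rat_field. a \<otimes>\<^bsub>rat_field\<^esub> b = \<one>\<^bsub>rat_field\<^esub>"
      by (intro bexI[of _ "inverse a"]) (simp_all add: rat_field_def)
  qed (simp add: rat_field_def)
qed

section \<open>The six-dimensional algebra\<close>

text \<open>
  The coordinates \<open>0, \<dots>, 5\<close> refer to the basis \<open>1, x, y, z, yx, zx\<close>.  Products of three basis elements
  from the radical vanish, so the multiplication is associative for any choice of the products of two.
\<close>

definition Lambda :: "rat \<Rightarrow> (rat, nat \<Rightarrow> rat) module" where
  "Lambda q =
     \<lparr>carrier = {a. \<forall>i\<ge>6. a i = 0},
      monoid.mult = (\<lambda>a b i.
        if i = 0 then a 0 * b 0
        else if i < 4 then a 0 * b i + a i * b 0
        else if i = 4 then a 0 * b 4 + a 4 * b 0 + a 2 * b 1 - q * a 1 * b 2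
        else if i = 5 then a 0 * b 5 + a 5 * b 0 + a 3 * b 1 + a 1 * b 3 + a 3 * b 2
        else 0),
      one = (\<lambda>i. if i = 0 then 1 else 0), ring.zero = (\<lambda>i. 0),
      add = (\<lambda>a b i. a i + b i), smult = (\<lambda>k a i. k * a i)\<rparr>"

lemma abelian_group_Lambda: "abelian_group (Lambda q)"
proof (rule abelian_groupI)
  fix a assume "a \<in> carrier (Lambda q)"
  then show "\<exists>b\<in>carrier (Lambda q). b \<oplus>\<^bsub>Lambda q\<^esub> a = \<zero>\<^bsub>Lambda q\<^esub>"
    by (intro bexI[of _ "\<lambda>i. - a i"]) (simp_all add: Lambda_def)
qed (simp_all add: Lambda_def fun_eq_iff)

lemma ring_Lambda: "ring (Lambda q)"
proof (rule ringI)
  show "abelian_group (Lambda q)" by (rule abelian_group_Lambda)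
  show "Group.monoid (Lambda q)"
    by (rule monoidI) (auto simp: Lambda_def fun_eq_iff algebra_simps)
qed (auto simp: Lambda_def fun_eq_iff algebra_simps)

lemma finsum_Lambda:
  assumes "finite S" "f \<in> S \<rightarrow> carrier (Lambda q)"
  shows "(\<Oplus>\<^bsub>Lambda q\<^esub>s\<in>S. f s) = (\<lambda>i. \<Sum>s\<in>S. f s i)"
  using assms
proof (induction S)
  case empty
  interpret abelian_group "Lambda q" by (rule abelian_group_Lambda)
  show ?case unfolding finsum_empty by (simp add: Lambda_def)
next
  case (insert s S)
  interpret abelian_group "Lambda q" by (rule abelian_group_Lambda)
  from insert have "(\<Oplus>\<^bsub>Lambda q\<^esub>s\<in>insert s S. f s) = f s \<oplus>\<^bsub>Lambda q\<^esub> (\<lambda>i. \<Sum>s\<in>S. f s i)"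
    by (subst finsum_insert) auto
  then show ?case using insert.hyps by (simp add: Lambda_def)
qed

lemma finitely_generated_Lambda: "finitely_generated rat_field (Lambda q)"
proof -
  define e :: "nat \<Rightarrow> nat \<Rightarrow> rat" where "e j = (\<lambda>i. if i = j then 1 else 0)" for j
  have inj: "inj_on e {..<6}"
    by (rule inj_onI) (metis e_def one_neq_zero)
  have sub: "e ` {..<6} \<subseteq> carrier (Lambda q)" by (auto simp: e_def Lambda_def)
  have "\<exists>c\<in>e ` {..<6} \<rightarrow> carrier rat_field.
      x = (\<Oplus>\<^bsub>Lambda q\<^esub>s\<in>e ` {..<6}. c s \<odot>\<^bsub>Lambda q\<^esub> s)"
    if x: "x \<in> carrier (Lambda q)" for x
  proof -
    define c where "c s = x (the_inv_into {..<6} e s)" for s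
    have c: "c (e j) = x j" if "j < 6" for j
      using the_inv_into_f_f[OF inj, of j] that by (simp add: c_def)
    have "(\<Oplus>\<^bsub>Lambda q\<^esub>s\<in>e ` {..<6}. c s \<odot>\<^bsub>Lambda q\<^esub> s)
        = (\<lambda>i. \<Sum>s\<in>e ` {..<6}. (c s \<odot>\<^bsub>Lambda q\<^esub> s) i)"
      using sub by (intro finsum_Lambda) (auto simp: Lambda_def)
    also have "\<dots> = (\<lambda>i. \<Sum>j<6. if i = j then x j else 0)"
      unfolding sum.reindex[OF inj]
      by (intro ext sum.cong) (auto simp: c Lambda_def, simp_all add: e_def)
    also have "\<dots> = x" using x by (auto simp: Lambda_def)
    finally show ?thesis by (intro bexI[of _ c]) (auto simp: rat_field_def)
  qed
  then show ?thesis
    unfolding finitely_generated_def using sub by (intro exI[of _ "e ` {..<6}"]) auto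
qed

lemma artin_algebra_Lambda: "artin_algebra rat_field (Lambda q)"
proof -
  have "artinian_cring rat_field" by (rule artinian_cring_of_field) (rule field_rat_field)
  moreover from this have "cring rat_field" by (simp add: artinian_cring_def)
  moreover from this have "module rat_field (Lambda q)"
    using abelian_group_Lambda[of q]
    by (simp add: module_def module_axioms_def)
      (simp add: Lambda_def rat_field_def fun_eq_iff algebra_simps)
  ultimately show ?thesis
    using ring_Lambda[of q] finitely_generated_Lambda[of q]
    by (simp add: artin_algebra_def artin_algebra_axioms_def)
      (auto simp: Lambda_def fun_eq_iff algebra_simps)
qed

text \<open>
  The element \<open>x - c y\<close>.
\<close>

definition omega :: "rat \<Rightarrow> nat \<Rightarrow> rat" where
  "omega c = (\<lambda>i. if i = 1 then 1 else if i = 2 then - c else 0)"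

lemma omega_closed: "omega c \<in> carrier (Lambda q)"
  by (simp add: omega_def Lambda_def)

text \<open>
  The subspace spanned by \<open>x - c y\<close> and the square of the radical.  The left and right ideals
  generated by an \<open>omega c\<close> and its two annihilators have this form, except for the left ideal and the
  left annihilator if \<open>c = 1\<close>.
\<close>

definition omega_ideal :: "rat \<Rightarrow> (nat \<Rightarrow> rat) set" where
  "omega_ideal c = {a. (\<forall>i\<ge>6. a i = 0) \<and> a 0 = 0 \<and> a 3 = 0 \<and> a 2 = - c * a 1}"

lemma omega_ideal_subset: "a \<in> omega_ideal c \<Longrightarrow> a \<in> carrier (Lambda q)"
  by (simp add: omega_ideal_def Lambda_def)

lemma less_6_cases: "(i::nat) < 6 \<Longrightarrow> i = 0 \<or> i = 1 \<or> i = 2 \<or> i = 3 \<or> i = 4 \<or> i = 5"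
  by arith

lemma Lambda_eqI:
  assumes "a \<in> carrier (Lambda q)" "b \<in> carrier (Lambda q)"
    and "a 0 = b 0" "a 1 = b 1" "a 2 = b 2" "a 3 = b 3" "a 4 = b 4" "a 5 = b 5"
  shows "a = b"
proof
  fix i
  show "a i = b i"
    using less_6_cases[of i] assms by (cases "i < 6") (auto simp: Lambda_def)
qed

lemma mult_omega:
  "a \<otimes>\<^bsub>Lambda q\<^esub> omega c = (\<lambda>i. if i = 1 then a 0 else if i = 2 then - c * a 0
     else if i = 4 then a 2 + c * q * a 1 else if i = 5 then (1 - c) * a 3 else 0)"
  by (auto simp: Lambda_def omega_def fun_eq_iff algebra_simps)

lemma omega_mult:
  "omega c \<otimes>\<^bsub>Lambda q\<^esub> a = (\<lambda>i. if i = 1 then a 0 else if i = 2 then - c * a 0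
     else if i = 4 then - c * a 1 - q * a 2 else if i = 5 then a 3 else 0)"
  by (auto simp: Lambda_def omega_def fun_eq_iff algebra_simps)

text \<open>
  Left multiplication of \<open>x - c y\<close> by \<open>y\<close> and \<open>z\<close> gives \<open>yx\<close> and \<open>(1 - c) zx\<close>; the second one is lost
  for \<open>c = 1\<close>.
\<close>

lemma PIdl_omega:
  assumes "c \<noteq> 1"
  shows "PIdl\<^bsub>Lambda q\<^esub> (omega c) = omega_ideal c"
proof
  show "PIdl\<^bsub>Lambda q\<^esub> (omega c) \<subseteq> omega_ideal c"
    by (auto simp: cgenideal_def mult_omega omega_ideal_def)
  show "omega_ideal c \<subseteq> PIdl\<^bsub>Lambda q\<^esub> (omega c)"
  proof
    fix a assume a: "a \<in> omega_ideal c"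
    let ?b = "\<lambda>i::nat. if i = 0 then a 1 else if i = 2 then a 4 else if i = 3 then a 5 / (1 - c) else 0"
    have b: "?b \<in> carrier (Lambda q)" by (simp add: Lambda_def)
    have "a = ?b \<otimes>\<^bsub>Lambda q\<^esub> omega c"
    proof (rule Lambda_eqI)
      show "a \<in> carrier (Lambda q)" by (rule omega_ideal_subset[OF a])
      show "?b \<otimes>\<^bsub>Lambda q\<^esub> omega c \<in> carrier (Lambda q)" unfolding mult_omega by (simp add: Lambda_def)
    qed (use a assms in \<open>simp_all add: mult_omega omega_ideal_def\<close>)
    with b show "a \<in> PIdl\<^bsub>Lambda q\<^esub> (omega c)" unfolding cgenideal_def by blast
  qed
qed

text \<open>
  Right multiplication of \<open>x - c y\<close> by \<open>y\<close> and \<open>z\<close> gives \<open>- q yx\<close> and \<open>zx\<close>, whatever \<open>c\<close> is.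
\<close>

lemma PIdl_opposite_omega:
  assumes "q \<noteq> 0"
  shows "PIdl\<^bsub>opposite (Lambda q)\<^esub> (omega c) = omega_ideal c"
proof
  show "PIdl\<^bsub>opposite (Lambda q)\<^esub> (omega c) \<subseteq> omega_ideal c"
    by (auto simp: cgenideal_def omega_mult omega_ideal_def)
  show "omega_ideal c \<subseteq> PIdl\<^bsub>opposite (Lambda q)\<^esub> (omega c)"
  proof
    fix a assume a: "a \<in> omega_ideal c"
    let ?b = "\<lambda>i::nat. if i = 0 then a 1 else if i = 2 then - a 4 / q else if i = 3 then a 5 else 0"
    have b: "?b \<in> carrier (opposite (Lambda q))" by (simp add: Lambda_def)
    have "a = ?b \<otimes>\<^bsub>opposite (Lambda q)\<^esub> omega c"
    proof (rule Lambda_eqI)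
      show "a \<in> carrier (Lambda q)" by (rule omega_ideal_subset[OF a])
      show "?b \<otimes>\<^bsub>opposite (Lambda q)\<^esub> omega c \<in> carrier (Lambda q)"
        unfolding opposite_sel omega_mult by (simp add: Lambda_def)
    qed (use a assms in \<open>simp_all add: omega_mult omega_ideal_def\<close>)
    with b show "a \<in> PIdl\<^bsub>opposite (Lambda q)\<^esub> (omega c)" unfolding cgenideal_def by blast
  qed
qed

lemma annihilator_omega:
  assumes "c \<noteq> 1"
  shows "annihilator (Lambda q) (omega c) = omega_ideal (q * c)"
proof -
  have "a \<otimes>\<^bsub>Lambda q\<^esub> omega c = \<zero>\<^bsub>Lambda q\<^esub> \<longleftrightarrow> a 0 = 0 \<and> a 3 = 0 \<and> a 2 = - (q * c) * a 1" for a
  proof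
    assume "a \<otimes>\<^bsub>Lambda q\<^esub> omega c = \<zero>\<^bsub>Lambda q\<^esub>"
    then have "(a \<otimes>\<^bsub>Lambda q\<^esub> omega c) i = 0" for i by (simp add: Lambda_def)
    from this[of 1] this[of 4] this[of 5] show "a 0 = 0 \<and> a 3 = 0 \<and> a 2 = - (q * c) * a 1"
      using assms by (simp add: mult_omega algebra_simps)
  qed (simp add: mult_omega, simp add: Lambda_def fun_eq_iff)
  then show ?thesis by (auto simp: annihilator_def omega_ideal_def Lambda_def)
qed

lemma annihilator_opposite_omega:
  assumes "q \<noteq> 0"
  shows "annihilator (opposite (Lambda q)) (omega (q * c)) = omega_ideal c"
proof -
  have "omega (q * c) \<otimes>\<^bsub>Lambda q\<^esub> a = \<zero>\<^bsub>Lambda q\<^esub> \<longleftrightarrow> a 0 = 0 \<and> a 3 = 0 \<and> a 2 = - c * a 1" for a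
  proof
    assume "omega (q * c) \<otimes>\<^bsub>Lambda q\<^esub> a = \<zero>\<^bsub>Lambda q\<^esub>"
    then have 0: "(omega (q * c) \<otimes>\<^bsub>Lambda q\<^esub> a) i = 0" for i by (simp add: Lambda_def)
    have "q * (a 2 + c * a 1) = 0" using 0[of 4] by (simp add: omega_mult algebra_simps)
    then have "a 2 = - c * a 1" using assms by (simp add: eq_neg_iff_add_eq_0)
    with 0[of 1] 0[of 5] show "a 0 = 0 \<and> a 3 = 0 \<and> a 2 = - c * a 1"
      by (simp add: omega_mult)
  qed (simp add: omega_mult, simp add: Lambda_def fun_eq_iff)
  then show ?thesis by (auto simp: annihilator_def omega_ideal_def Lambda_def)
qed

lemma annihilator_eq_PIdl:
  assumes "c \<noteq> 1" "q * c \<noteq> 1"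
  shows "annihilator (Lambda q) (omega c) = PIdl\<^bsub>Lambda q\<^esub> (omega (q * c))"
  using assms by (simp add: annihilator_omega PIdl_omega)

lemma annihilator_opposite_eq_PIdl:
  assumes "q \<noteq> 0"
  shows "annihilator (opposite (Lambda q)) (omega (q * c)) = PIdl\<^bsub>opposite (Lambda q)\<^esub> (omega c)"
  using assms by (simp add: annihilator_opposite_omega PIdl_opposite_omega)

definition z_Lambda :: "nat \<Rightarrow> rat" where
  "z_Lambda = (\<lambda>i. if i = 3 then 1 else 0)"

lemma z_annihilates_omega_1: "z_Lambda \<in> annihilator (Lambda q) (omega 1)"
proof -
  have "z_Lambda \<otimes>\<^bsub>Lambda q\<^esub> omega 1 = \<zero>\<^bsub>Lambda q\<^esub>" 
    unfolding mult_omega by (simp add: z_Lambda_def Lambda_def fun_eq_iff)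
  then show ?thesis by (simp add: annihilator_def) (simp add: z_Lambda_def Lambda_def)
qed

lemma z_notin_PIdl_omega:
  assumes "c \<noteq> 1"
  shows "z_Lambda \<notin> PIdl\<^bsub>Lambda q\<^esub> (omega c)"
  using assms by (simp add: PIdl_omega omega_ideal_def z_Lambda_def)

section \<open>The three-dimensional modules\<close>

text \<open>
  The basis is \<open>v, v', v''\<close>, where \<open>x v = c v'\<close>, \<open>y v = v'\<close>, \<open>z v = v''\<close>, and the radical kills \<open>v'\<close> and
  \<open>v''\<close>.  Since the square of the radical acts as zero, the order of the factors in a product does not
  matter, and this is a left module over the algebra and also over its opposite.
\<close>

definition M3 :: "rat \<Rightarrow> (nat \<Rightarrow> rat, nat \<Rightarrow> rat) module" where
  "M3 c =
     \<lparr>carrier = {m. \<forall>i\<ge>3. m i = 0}, monoid.mult = undefined, one = undefined,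
      ring.zero = (\<lambda>i. 0), add = (\<lambda>m n i. m i + n i),
      smult = (\<lambda>a m i.
        if i = 0 then a 0 * m 0
        else if i = 1 then a 0 * m 1 + (c * a 1 + a 2) * m 0
        else if i = 2 then a 0 * m 2 + a 3 * m 0
        else 0)\<rparr>"

lemma abelian_group_M3: "abelian_group (M3 c)"
proof (rule abelian_groupI)
  fix m assume "m \<in> carrier (M3 c)"
  then show "\<exists>n\<in>carrier (M3 c). n \<oplus>\<^bsub>M3 c\<^esub> m = \<zero>\<^bsub>M3 c\<^esub>"
    by (intro bexI[of _ "\<lambda>i. - m i"]) (simp_all add: M3_def)
qed (simp_all add: M3_def fun_eq_iff)

lemma left_module_M3: "left_module (Lambda q) (M3 c)"
  unfolding left_module_def left_module_axioms_def
  using ring_Lambda abelian_group_M3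
  by (auto simp: M3_def Lambda_def fun_eq_iff algebra_simps less_Suc_eq numeral_3_eq_3)

lemma left_module_opposite_M3: "left_module (opposite (Lambda q)) (M3 c)"
  unfolding left_module_def left_module_axioms_def
  using ring_opposite[OF ring_Lambda] abelian_group_M3
  by (auto simp: M3_def Lambda_def fun_eq_iff algebra_simps less_Suc_eq numeral_3_eq_3)

definition v_M3 :: "nat \<Rightarrow> rat" where
  "v_M3 = (\<lambda>i. if i = 0 then 1 else 0)"

lemma v_M3_closed: "v_M3 \<in> carrier (M3 c)"
  by (simp add: v_M3_def M3_def)

lemma smult_v:
  "a \<odot>\<^bsub>M3 c\<^esub> v_M3 = (\<lambda>i. if i = 0 then a 0 else if i = 1 then c * a 1 + a 2 else if i = 2 then a 3 else 0)"
  by (auto simp: M3_def v_M3_def fun_eq_iff)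

lemma smult_v_surj: "(\<lambda>a. a \<odot>\<^bsub>M3 c\<^esub> v_M3) ` carrier (Lambda q) = carrier (M3 c)"
proof
  show "carrier (M3 c) \<subseteq> (\<lambda>a. a \<odot>\<^bsub>M3 c\<^esub> v_M3) ` carrier (Lambda q)"
  proof
    fix m assume m: "m \<in> carrier (M3 c)"
    let ?a = "\<lambda>i::nat. if i = 0 then m 0 else if i = 2 then m 1 else if i = 3 then m 2 else 0"
    have "m i = (?a \<odot>\<^bsub>M3 c\<^esub> v_M3) i" for i
      using m unfolding smult_v by (auto simp: M3_def)
    then show "m \<in> (\<lambda>a. a \<odot>\<^bsub>M3 c\<^esub> v_M3) ` carrier (Lambda q)"
      by (intro image_eqI[where x = ?a]) (auto simp: Lambda_def)
  qed
qed (auto simp: smult_v, auto simp: M3_def)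

lemma annihilator_v_M3:
  "{a \<in> carrier (Lambda q). a \<odot>\<^bsub>M3 c\<^esub> v_M3 = \<zero>\<^bsub>M3 c\<^esub>} = omega_ideal c"
proof -
  have "a \<odot>\<^bsub>M3 c\<^esub> v_M3 = \<zero>\<^bsub>M3 c\<^esub> \<longleftrightarrow> a 0 = 0 \<and> a 3 = 0 \<and> a 2 = - c * a 1" for a
  proof
    assume "a \<odot>\<^bsub>M3 c\<^esub> v_M3 = \<zero>\<^bsub>M3 c\<^esub>"
    then have "(a \<odot>\<^bsub>M3 c\<^esub> v_M3) i = 0" for i by (simp add: M3_def)
    from this[of 0] this[of 1] this[of 2] show "a 0 = 0 \<and> a 3 = 0 \<and> a 2 = - c * a 1"
      by (simp add: smult_v)
  qed (simp add: smult_v, simp add: M3_def fun_eq_iff)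
  then show ?thesis by (auto simp: omega_ideal_def Lambda_def)
qed

lemma M3_presented_by:
  assumes "c \<noteq> 1"
  shows "presented_by (Lambda q) (M3 c) v_M3 (omega c)"
  using assms
  by (simp add: presented_by_def v_M3_closed omega_closed smult_v_surj annihilator_v_M3 PIdl_omega)

lemma M3_presented_by_opposite:
  assumes "q \<noteq> 0"
  shows "presented_by (opposite (Lambda q)) (M3 c) v_M3 (omega c)"
  using assms
  by (simp add: presented_by_def v_M3_closed omega_closed smult_v_surj annihilator_v_M3
      PIdl_opposite_omega)

text \<open>
  The parameters \<open>q^n c\<close> of the resolution avoid \<open>1\<close>, which makes it exact; its dual is exact because
  right annihilators are never exceptional.
\<close>

lemma semi_gorenstein_projective_Lambda:
  assumes U: "left_module (Lambda q) U" and pres: "presented_by (Lambda q) U g (omega c)"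
    and q: "q \<noteq> 0" and c: "\<And>n. q ^ n * c \<noteq> 1"
  shows "semi_gorenstein_projective (Lambda q) U"
proof -
  let ?w = "\<lambda>i. omega (q ^ i * c)"
  have p: "presented_by (Lambda q) U g (?w 0)" using pres by simp
  have a: "annihilator (Lambda q) (?w i) = PIdl\<^bsub>Lambda q\<^esub> (?w (Suc i))" for i
    using annihilator_eq_PIdl[of "q ^ i * c" q] c[of i] c[of "Suc i"] by (simp add: mult.assoc)
  have b: "annihilator (opposite (Lambda q)) (?w (Suc n)) = PIdl\<^bsub>opposite (Lambda q)\<^esub> (?w n)" for n
    using annihilator_opposite_eq_PIdl[OF q, of "q ^ n * c"] by (simp add: mult.assoc)
  show ?thesis
    using cyclic_semi_gorenstein_projective_iff[of "Lambda q" U g ?w, OF U p omega_closed a] b by blast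
qed

text \<open>
  On this side the roles are exchanged: the resolution by \<open>omega (c / q^n)\<close> exists for every \<open>c\<close>, and the
  exceptional parameter \<open>1\<close> can only spoil the exactness of its dual.
\<close>

lemma semi_gorenstein_projective_opposite_Lambda_iff:
  assumes U: "left_module (opposite (Lambda q)) U" and pres: "presented_by (opposite (Lambda q)) U g (omega c)"
    and q: "q \<noteq> 0"
  shows "semi_gorenstein_projective (opposite (Lambda q)) U \<longleftrightarrow>
    (\<forall>n. annihilator (Lambda q) (omega (c / q ^ Suc n)) \<subseteq> PIdl\<^bsub>Lambda q\<^esub> (omega (c / q ^ n)))"
proof -
  let ?w = "\<lambda>i. omega (c / q ^ i)"
  have p: "presented_by (opposite (Lambda q)) U g (?w 0)" using pres by simp
  have a: "annihilator (opposite (Lambda q)) (?w i) = PIdl\<^bsub>opposite (Lambda q)\<^esub> (?w (Suc i))" for i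
    using annihilator_opposite_eq_PIdl[OF q, of "c / q ^ Suc i"] q by simp
  have cl: "?w i \<in> carrier (opposite (Lambda q))" for i by (simp add: omega_closed)
  show ?thesis
    using cyclic_semi_gorenstein_projective_iff[of "opposite (Lambda q)" U g ?w, OF U p cl a] by simp
qed

lemma semi_gorenstein_projective_opposite_Lambda:
  assumes U: "left_module (opposite (Lambda q)) U" and pres: "presented_by (opposite (Lambda q)) U g (omega c)"
    and q: "q \<noteq> 0" and c: "\<And>n. c \<noteq> q ^ n"
  shows "semi_gorenstein_projective (opposite (Lambda q)) U"
proof -
  have n: "c / q ^ n \<noteq> 1" for n using c[of n] q by simp
  have "annihilator (Lambda q) (omega (c / q ^ Suc n)) = PIdl\<^bsub>Lambda q\<^esub> (omega (c / q ^ n))" for n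
    using annihilator_eq_PIdl[of "c / q ^ Suc n" q] n[of n] n[of "Suc n"] q by simp
  then show ?thesis
    unfolding semi_gorenstein_projective_opposite_Lambda_iff[OF U pres q] by simp
qed

text \<open>
  The second map of the resolution is given by \<open>omega 1\<close>, and \<open>z\<close> is a cocycle in degree \<open>1\<close> that is not a
  coboundary.
\<close>

lemma not_semi_gorenstein_projective_opposite_Lambda:
  assumes U: "left_module (opposite (Lambda q)) U" and pres: "presented_by (opposite (Lambda q)) U g (omega q)"
    and q: "q \<noteq> 0" "q \<noteq> 1"
  shows "\<not> semi_gorenstein_projective (opposite (Lambda q)) U"
proof
  assume "semi_gorenstein_projective (opposite (Lambda q)) U"
  then have "annihilator (Lambda q) (omega (q / q ^ Suc 0)) \<subseteq> PIdl\<^bsub>Lambda q\<^esub> (omega (q / q ^ 0))"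
    unfolding semi_gorenstein_projective_opposite_Lambda_iff[OF U pres q(1)] by blast
  then have "annihilator (Lambda q) (omega 1) \<subseteq> PIdl\<^bsub>Lambda q\<^esub> (omega q)" using q by simp
  then show False using z_annihilates_omega_1 z_notin_PIdl_omega[OF q(2)] by blast
qed

section \<open>Independence\<close>

lemma right_chain_2:
  "annihilator (opposite (Lambda 2)) (omega c) = PIdl\<^bsub>opposite (Lambda 2)\<^esub> (omega (c / 2))"
  using annihilator_opposite_eq_PIdl[of 2 "c / 2"] by simp

lemma left_chain_2:
  assumes "c \<noteq> 1" "c \<noteq> 1 / 2"
  shows "annihilator (Lambda 2) (omega c) = PIdl\<^bsub>Lambda 2\<^esub> (omega (2 * c))"
  using annihilator_eq_PIdl[of c 2] assms by simp

lemma two_power_neq_one: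
  assumes "1 < c"
  shows "2 ^ n * c \<noteq> (1::rat)"
proof -
  have "(1::rat) \<le> 2 ^ n" by simp
  then have "1 * 1 < 2 ^ n * c" using assms by (intro mult_le_less_imp_less) auto
  then show ?thesis by simp
qed

text \<open>
  The dual is presented by \<open>omega 8\<close> over \<open>Lambda 2\<close>, so its syzygies have the parameters
  \<open>16, 32, \<dots>\<close>, which stay away from \<open>1\<close>.
\<close>

lemma example_G1_fails:
  "\<not> semi_gorenstein_projective (opposite (Lambda 2)) (M3 2)"
  "semi_gorenstein_projective (opposite (opposite (Lambda 2))) (dual (opposite (Lambda 2)) (M3 2))"
  "reflexive (opposite (Lambda 2)) (M3 2)"
proof -
  let ?A = "Lambda 2" let ?B = "opposite ?A"
  note U = left_module_opposite_M3[of 2 2]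
  have pres: "presented_by ?B (M3 2) v_M3 (omega 2)" by (rule M3_presented_by_opposite) simp
  show "\<not> semi_gorenstein_projective ?B (M3 2)"
    by (rule not_semi_gorenstein_projective_opposite_Lambda[OF U pres]) simp_all
  have cl: "omega c \<in> carrier ?B" for c by (simp add: omega_closed)
  have u: "annihilator (opposite ?B) (omega 2) = PIdl\<^bsub>opposite ?B\<^esub> (omega 4)"
    and w': "annihilator (opposite ?B) (omega 4) = PIdl\<^bsub>opposite ?B\<^esub> (omega 8)"
    using left_chain_2[of 2] left_chain_2[of 4] by simp_all
  obtain g where g: "presented_by (opposite ?B) (dual ?B (M3 2)) g (omega 8)"
    using dual_presented_by[OF U pres cl u cl w'] by blast
  have D: "left_module ?A (dual ?B (M3 2))" using left_module_dual[OF U] by simp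
  have "semi_gorenstein_projective ?A (dual ?B (M3 2))"
    by (rule semi_gorenstein_projective_Lambda[OF D, of g 8])
      (use g two_power_neq_one[of 8] in simp_all)
  then show "semi_gorenstein_projective (opposite ?B) (dual ?B (M3 2))" by simp
  show "reflexive ?B (M3 2)"
    by (rule cyclic_reflexive[OF U pres cl u cl w']) (simp_all add: right_chain_2)
qed

text \<open>
  The dual is presented by \<open>omega 2\<close>, so its resolution meets the parameter \<open>1\<close> in the next step, while
  the bidual only involves \<open>2\<close>, \<open>4\<close> and \<open>8\<close>.
\<close>

lemma example_G2_fails:
  "semi_gorenstein_projective (Lambda 2) (M3 8)"
  "\<not> semi_gorenstein_projective (opposite (Lambda 2)) (dual (Lambda 2) (M3 8))"
  "reflexive (Lambda 2) (M3 8)"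
proof -
  let ?A = "Lambda 2" let ?B = "opposite ?A"
  note U = left_module_M3[of 2 8]
  have pres: "presented_by ?A (M3 8) v_M3 (omega 8)" by (rule M3_presented_by) simp
  show "semi_gorenstein_projective ?A (M3 8)"
    by (rule semi_gorenstein_projective_Lambda[OF U pres]) (use two_power_neq_one[of 8] in simp_all)
  have u: "annihilator ?B (omega 8) = PIdl\<^bsub>?B\<^esub> (omega 4)" and w': "annihilator ?B (omega 4) = PIdl\<^bsub>?B\<^esub> (omega 2)"
    by (simp_all add: right_chain_2)
  obtain g where g: "presented_by ?B (dual ?A (M3 8)) g (omega 2)"
    using dual_presented_by[OF U pres omega_closed u omega_closed w'] by blast
  show "\<not> semi_gorenstein_projective ?B (dual ?A (M3 8))"
    by (rule not_semi_gorenstein_projective_opposite_Lambda[OF left_module_dual[OF U] g]) simp_all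
  show "reflexive ?A (M3 8)"
    by (rule cyclic_reflexive[OF U pres omega_closed u omega_closed w']) (simp_all add: left_chain_2)
qed

text \<open>
  The dual is presented by \<open>omega (1/2)\<close> and its syzygies have the parameters \<open>1/4, 1/8, \<dots>\<close>, so
  the parameter \<open>1\<close> is jumped over.  It is the parameter of the ideal in which the homomorphisms take their
  values on the generator, and this is what destroys reflexivity.
\<close>

lemma example_G3_fails:
  "semi_gorenstein_projective (Lambda 2) (M3 2)"
  "semi_gorenstein_projective (opposite (Lambda 2)) (dual (Lambda 2) (M3 2))"
  "\<not> reflexive (Lambda 2) (M3 2)"
proof -
  let ?A = "Lambda 2" let ?B = "opposite ?A"
  note U = left_module_M3[of 2 2]
  have pres: "presented_by ?A (M3 2) v_M3 (omega 2)" by (rule M3_presented_by) simp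
  show "semi_gorenstein_projective ?A (M3 2)"
    by (rule semi_gorenstein_projective_Lambda[OF U pres]) (use two_power_neq_one[of 2] in simp_all)
  have u: "annihilator ?B (omega 2) = PIdl\<^bsub>?B\<^esub> (omega 1)" and w': "annihilator ?B (omega 1) = PIdl\<^bsub>?B\<^esub> (omega (1/2))"
    by (simp_all add: right_chain_2)
  obtain g where g: "presented_by ?B (dual ?A (M3 2)) g (omega (1/2))"
    using dual_presented_by[OF U pres omega_closed u omega_closed w'] by blast
  have "1 / 2 \<noteq> (2::rat) ^ n" for n
  proof -
    have "(1::rat) \<le> 2 ^ n" by simp
    then show ?thesis by linarith
  qed
  then show "semi_gorenstein_projective ?B (dual ?A (M3 2))"
    by (intro semi_gorenstein_projective_opposite_Lambda[OF left_module_dual[OF U] g]) simp_all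
  have "z_Lambda \<notin> PIdl\<^bsub>?A\<^esub> (omega 2)" by (rule z_notin_PIdl_omega) simp
  with u show "\<not> reflexive ?A (M3 2)"
    by (intro cyclic_not_reflexive[OF U pres omega_closed _ z_annihilates_omega_1]) simp_all
qed

lemma finitely_generated_M3:
  "finitely_generated (Lambda q) (M3 c)" "finitely_generated (opposite (Lambda q)) (M3 c)"
proof -
  show "finitely_generated (Lambda q) (M3 c)"
    by (rule finitely_generated_of_cyclic[OF left_module_M3 v_M3_closed smult_v_surj])
  show "finitely_generated (opposite (Lambda q)) (M3 c)"
    by (rule finitely_generated_of_cyclic[OF left_module_opposite_M3 v_M3_closed]) (simp add: smult_v_surj)
qed

(* HOL cannot quantify existentially over types, so the element types of the witnesses have to be
   named.  They are only ambient types: K, A and M are arbitrary records on subsets of them. *)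
theorem theorem1p7:
  shows
    "(\<exists>(K :: rat ring) (A :: (rat, nat \<Rightarrow> rat) module) (M :: (nat \<Rightarrow> rat, nat \<Rightarrow> rat) module).
        artin_algebra K A \<and> left_module A M \<and> finitely_generated A M \<and>
        \<not> semi_gorenstein_projective A M \<and>
        semi_gorenstein_projective (opposite A) (dual A M) \<and>
        reflexive A M) \<and>
     (\<exists>(K :: rat ring) (A :: (rat, nat \<Rightarrow> rat) module) (M :: (nat \<Rightarrow> rat, nat \<Rightarrow> rat) module).
        artin_algebra K A \<and> left_module A M \<and> finitely_generated A M \<and>
        semi_gorenstein_projective A M \<and>
        \<not> semi_gorenstein_projective (opposite A) (dual A M) \<and>
        reflexive A M) \<and>
     (\<exists>(K :: rat ring) (A :: (rat, nat \<Rightarrow> rat) module) (M :: (nat \<Rightarrow> rat, nat \<Rightarrow> rat) module).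
        artin_algebra K A \<and> left_module A M \<and> finitely_generated A M \<and>
        semi_gorenstein_projective A M \<and>
        semi_gorenstein_projective (opposite A) (dual A M) \<and>
        \<not> reflexive A M)"
  using artin_algebra_Lambda[of 2] artin_algebra_opposite[OF artin_algebra_Lambda[of 2]]
    left_module_M3[of 2] left_module_opposite_M3[of 2] finitely_generated_M3
    example_G1_fails example_G2_fails example_G3_fails
  by blast

end
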